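(* For the single network core coflow scheduling problem with precedence constraints, in the special case where all coflows are released at time zero, the algorithm single-network-core-list-scheduling has an approximation ratio of at most $4\mu$ for minimizing the total weighted coflow completion time $\sum_{k\in\mathcal{K}} w_kC_k$, where $\mu$ is the maximum number of coflows on a directed path of the precedence graph.
   Context: Single network core: one $N\times N$ non-blocking switch with input ports $i\in\mathcal{I}=\{1,\dots,N\}$ (source servers) and output ports $j\in\mathcal{J}=\{1,\dots,N\}$ (destination servers), all links of unit capacity. An instance is a finite set $\mathcal{K}$ of coflows; coflow $k$ has a demand matrix $(d_{ijk})_{i,j=1}^N$ of nonnegative integers, a release time $r_k\ge0$ and a nonnegative weight $w_k$. A flow is a triple $(i,j,k)$ with $d_{ijk}>0$, i.e. $d_{ijk}$ units of data from input $i$ to output $j$. At every time each input port sends at total rate at most $1$ and each output port receives at total rate at most $1$; no data of coflow $k$ is sent before $r_k$. Precedence constraints are given by a directed acyclic graph $G=(\mathcal{K},E)$: if $(k',k)\in E$ (written $k'\prec k$), no flow of $k$ may be transmitted before all flows of $k'$ have completed; a flow/coflow is ready once all flows of all its predecessor coflows have completed. The completion time $C_k$ of coflow $k$ is the completion time of its last flow. $\mu$ is the maximum number of coflows on a directed path in $G$. An algorithm has approximation ratio at most $\alpha$ if on every instance its schedule has objective value at most $\alpha$ times the optimum. Let $L_{ik}=\sum_j d_{ijk}$, $L_{jk}=\sum_i d_{ijk}$. Linear program LP-S, variables $C_k$: minimize $\sum_k w_kC_k$ subject to $C_k\ge r_k+L_{ik}$, $C_k\ge r_k+L_{jk}$ for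 all $k,i,j$; $C_k\ge C_{k'}+L_{ik}$, $C_k\ge C_{k'}+L_{jk}$ for all $i,j$, $k'\prec k$; for every input $i$ and $S\subseteq\mathcal{K}$: $\sum_{k\in S}L_{ik}C_k\ge\frac12\big(\sum_{k\in S}L_{ik}^2+(\sum_{k\in S}L_{ik})^2\big)$, and the same for every output $j$ with $L_{jk}$. Algorithm single-network-core-list-scheduling: compute an optimal solution $\bar C$ of LP-S; each flow $f=(i,j,k)$ gets priority $\bar C_f=\bar C_k$. Wait until the first coflow is released; while some flow is incomplete, go through every ready, released and incomplete flow $f=(i,j,k)$ in non-decreasing order of $\bar C_f$ (ties arbitrary) and schedule $f$ if the link $(i,j)$ is idle (neither input $i$ nor output $j$ is used by an already scheduled flow); transmit the scheduled flows at rate $1$ until some new flow becomes ready, completes or is released, and repeat. *)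

theory Defs
  imports "HOL-Analysis.Analysis"
begin

section \<open>Instances\<close>

text \<open>Coflows are the elements of an arbitrary type \<open>'k\<close>; input ports and output ports are both
  numbered \<open>1, ..., N\<close>.  Only demands between such ports and only coflows in
  \<open>coflows I\<close> are meaningful.  A pair \<open>(k', k)\<close> in \<open>prec I\<close> says that \<open>k'\<close> precedes \<open>k\<close>.\<close>

record 'k coflow_instance =
  ports :: nat
  coflows :: "'k set"
  demand :: "nat \<Rightarrow> nat \<Rightarrow> 'k \<Rightarrow> nat"
  release :: "'k \<Rightarrow> real"
  weight :: "'k \<Rightarrow> real"
  prec :: "('k \<times> 'k) set"

definition valid_instance :: "'k coflow_instance \<Rightarrow> bool" where
  "valid_instance I \<longleftrightarrow>
     1 \<le> ports I \<and> finite (coflows I) \<and>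
     (\<forall>k\<in>coflows I. 0 \<le> release I k) \<and> (\<forall>k\<in>coflows I. 0 \<le> weight I k) \<and>
     prec I \<subseteq> coflows I \<times> coflows I \<and> acyclic (prec I)"

type_synonym 'k flow = "nat \<times> nat \<times> 'k"

definition inp :: "'k flow \<Rightarrow> nat" where "inp f = fst f"
definition outp :: "'k flow \<Rightarrow> nat" where "outp f = fst (snd f)"
definition cofl :: "'k flow \<Rightarrow> 'k" where "cofl f = snd (snd f)"

definition flow_demand :: "'k coflow_instance \<Rightarrow> 'k flow \<Rightarrow> real" where
  "flow_demand I f = real (demand I (inp f) (outp f) (cofl f))"

definition flows :: "'k coflow_instance \<Rightarrow> 'k flow set" where
  "flows I = {(i, j, k). i \<in> {1..ports I} \<and> j \<in> {1..ports I} \<and> k \<in> coflows I \<and> 0 < demand I i j k}"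

definition flows_of :: "'k coflow_instance \<Rightarrow> 'k \<Rightarrow> 'k flow set" where
  "flows_of I k = {f \<in> flows I. cofl f = k}"

definition in_load :: "'k coflow_instance \<Rightarrow> nat \<Rightarrow> 'k \<Rightarrow> real" where
  "in_load I i k = (\<Sum>j = 1..ports I. real (demand I i j k))"

definition out_load :: "'k coflow_instance \<Rightarrow> nat \<Rightarrow> 'k \<Rightarrow> real" where
  "out_load I j k = (\<Sum>i = 1..ports I. real (demand I i j k))"

text \<open>The empty list counts as a path so that the maximum is also defined (as 0) when there are
  no coflows.  Distinctness is automatic, the precedence graph being acyclic.\<close>

definition directed_path :: "'k coflow_instance \<Rightarrow> 'k list \<Rightarrow> bool" where
  "directed_path I p \<longleftrightarrow>
     set p \<subseteq> coflows I \<and> distinct p \<and> successively (\<lambda>k' k. (k', k) \<in> prec I) p"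

definition max_path_coflows :: "'k coflow_instance \<Rightarrow> nat" where
  "max_path_coflows I = Max {length p | p. directed_path I p}"


section \<open>Schedules\<close>

text \<open>A schedule gives the transmission rate of every flow at every time \<open>t \<ge> 0\<close>; in particular
  preemption and fractional sharing of ports are allowed.\<close>

type_synonym 'k schedule = "'k flow \<Rightarrow> real \<Rightarrow> real"

definition sent :: "'k schedule \<Rightarrow> 'k flow \<Rightarrow> real \<Rightarrow> real" where
  "sent x f t = integral {0..t} (x f)"

definition flow_completion :: "'k coflow_instance \<Rightarrow> 'k schedule \<Rightarrow> 'k flow \<Rightarrow> real" where
  "flow_completion I x f = Inf {t. 0 \<le> t \<and> flow_demand I f \<le> sent x f t}"

text \<open>A coflow may have no flow at all, in which case it has no last flow.  Such a coflow is taken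
  to complete as soon as it is released and all its predecessors are complete (the least value
  compatible with the precedence inequalities of the linear program below), and it still separates
  its predecessors from its successors.  This is why precedence constraints refer to the transitive
  closure of \<open>prec I\<close> and also to the release times of predecessors.  When every coflow
  has a flow, both additions are implied by the constraints for the immediate predecessors.\<close>

definition coflow_completion :: "'k coflow_instance \<Rightarrow> 'k schedule \<Rightarrow> 'k \<Rightarrow> real" where
  "coflow_completion I x k =
     (if flows_of I k \<noteq> {} then Max (flow_completion I x ` flows_of I k)
      else Max (release I ` {k'. (k', k) \<in> (prec I)\<^sup>*} \<union>
                flow_completion I x ` {f \<in> flows I. (cofl f, k) \<in> (prec I)\<^sup>+}))"

definition feasible :: "'k coflow_instance \<Rightarrow> 'k schedule \<Rightarrow> bool" where
  "feasible I x \<longleftrightarrow>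
     (\<forall>f\<in>flows I. \<forall>t\<ge>0. 0 \<le> x f t \<and> x f integrable_on {0..t}) \<and>
     (\<forall>i\<in>{1..ports I}. \<forall>t\<ge>0. (\<Sum>f | f \<in> flows I \<and> inp f = i. x f t) \<le> 1) \<and>
     (\<forall>j\<in>{1..ports I}. \<forall>t\<ge>0. (\<Sum>f | f \<in> flows I \<and> outp f = j. x f t) \<le> 1) \<and>
     (\<forall>f\<in>flows I. (\<forall>t\<ge>0. sent x f t \<le> flow_demand I f) \<and> (\<exists>t\<ge>0. sent x f t = flow_demand I f)) \<and>
     (\<forall>f\<in>flows I. \<forall>t\<ge>0. 0 < x f t \<longrightarrow> release I (cofl f) \<le> t) \<and>
     (\<forall>f\<in>flows I. \<forall>t\<ge>0. 0 < x f t \<longrightarrow>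
        (\<forall>k'. (k', cofl f) \<in> (prec I)\<^sup>+ \<longrightarrow>
           release I k' \<le> t \<and> (\<forall>g\<in>flows_of I k'. flow_completion I x g \<le> t)))"

definition cost :: "'k coflow_instance \<Rightarrow> 'k schedule \<Rightarrow> real" where
  "cost I x = (\<Sum>k\<in>coflows I. weight I k * coflow_completion I x k)"

definition opt :: "'k coflow_instance \<Rightarrow> real" where
  "opt I = Inf {cost I x | x. feasible I x}"


section \<open>The linear program LP-S\<close>

definition lp_feasible :: "'k coflow_instance \<Rightarrow> ('k \<Rightarrow> real) \<Rightarrow> bool" where
  "lp_feasible I C \<longleftrightarrow>
     (\<forall>k\<in>coflows I. \<forall>i\<in>{1..ports I}. C k \<ge> release I k + in_load I i k) \<and>
     (\<forall>k\<in>coflows I. \<forall>j\<in>{1..ports I}. C k \<ge> release I k + out_load I j k) \<and>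
     (\<forall>(k', k)\<in>prec I. \<forall>i\<in>{1..ports I}. C k \<ge> C k' + in_load I i k) \<and>
     (\<forall>(k', k)\<in>prec I. \<forall>j\<in>{1..ports I}. C k \<ge> C k' + out_load I j k) \<and>
     (\<forall>i\<in>{1..ports I}. \<forall>S\<subseteq>coflows I.
        (\<Sum>k\<in>S. in_load I i k * C k)
          \<ge> 1/2 * ((\<Sum>k\<in>S. (in_load I i k)\<^sup>2) + (\<Sum>k\<in>S. in_load I i k)\<^sup>2)) \<and>
     (\<forall>j\<in>{1..ports I}. \<forall>S\<subseteq>coflows I.
        (\<Sum>k\<in>S. out_load I j k * C k)
          \<ge> 1/2 * ((\<Sum>k\<in>S. (out_load I j k)\<^sup>2) + (\<Sum>k\<in>S. out_load I j k)\<^sup>2))"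

definition lp_value :: "'k coflow_instance \<Rightarrow> ('k \<Rightarrow> real) \<Rightarrow> real" where
  "lp_value I C = (\<Sum>k\<in>coflows I. weight I k * C k)"

definition lp_optimal :: "'k coflow_instance \<Rightarrow> ('k \<Rightarrow> real) \<Rightarrow> bool" where
  "lp_optimal I C \<longleftrightarrow> lp_feasible I C \<and> (\<forall>C'. lp_feasible I C' \<longrightarrow> lp_value I C \<le> lp_value I C')"


section \<open>The list scheduling algorithm\<close>

text \<open>The state of the algorithm is the current time \<open>t\<close> and the amount \<open>rem f\<close> of data of each
  flow that is still to be sent.\<close>

definition eligible :: "'k coflow_instance \<Rightarrow> real \<Rightarrow> ('k flow \<Rightarrow> real) \<Rightarrow> 'k flow set" where
  "eligible I t rem = {f \<in> flows I.
     0 < rem f \<and> release I (cofl f) \<le> t \<and>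
     (\<forall>k'. (k', cofl f) \<in> (prec I)\<^sup>+ \<longrightarrow>
        release I k' \<le> t \<and> (\<forall>g\<in>flows_of I k'. rem g \<le> 0))}"

definition link_idle :: "'k flow set \<Rightarrow> 'k flow \<Rightarrow> bool" where
  "link_idle A f \<longleftrightarrow> (\<forall>g\<in>A. inp g \<noteq> inp f \<and> outp g \<noteq> outp f)"

definition greedy :: "'k flow list \<Rightarrow> 'k flow set" where
  "greedy fs = fold (\<lambda>f A. if link_idle A f then insert f A else A) fs {}"

text \<open>Flows become ready only when some flow completes or some coflow is released, so these are
  the only events at which the set of transmitted flows is recomputed.\<close>

definition next_event ::
    "'k coflow_instance \<Rightarrow> real \<Rightarrow> ('k flow \<Rightarrow> real) \<Rightarrow> 'k flow set \<Rightarrow> real" where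
  "next_event I t rem A =
     Min ((\<lambda>f. t + rem f) ` A \<union> {release I k | k. k \<in> coflows I \<and> t < release I k})"

text \<open>\<open>list_run I C t rem segs\<close>: with priorities \<open>C\<close>, a run from the state \<open>(t, rem)\<close> ends after
  finitely many rounds with all flows completed; \<open>(s, e, A)\<close> in \<open>segs\<close> says that exactly the flows
  in \<open>A\<close> are transmitted, at rate 1, during \<open>[s, e)\<close>.  The arbitrary breaking of ties is the free
  choice of the sorted list \<open>fs\<close>, in every round.\<close>

inductive list_run ::
    "'k coflow_instance \<Rightarrow> ('k \<Rightarrow> real) \<Rightarrow> real \<Rightarrow> ('k flow \<Rightarrow> real) \<Rightarrow>
     (real \<times> real \<times> 'k flow set) list \<Rightarrow> bool"
  for I :: "'k coflow_instance" and C :: "'k \<Rightarrow> real" where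
  finished: "\<forall>f\<in>flows I. rem f \<le> 0 \<Longrightarrow> list_run I C t rem []"
| round: "\<lbrakk>\<exists>f\<in>flows I. 0 < rem f;
     distinct fs; set fs = eligible I t rem; sorted (map (\<lambda>f. C (cofl f)) fs);
     A = greedy fs; t' = next_event I t rem A;
     list_run I C t' (\<lambda>f. if f \<in> A then rem f - (t' - t) else rem f) segs\<rbrakk>
   \<Longrightarrow> list_run I C t rem ((t, t', A) # segs)"

definition schedule_of :: "(real \<times> real \<times> 'k flow set) list \<Rightarrow> 'k schedule" where
  "schedule_of segs f t = (if \<exists>(s, e, A)\<in>set segs. s \<le> t \<and> t < e \<and> f \<in> A then 1 else 0)"

text \<open>\<open>list_scheduling I x\<close>: the algorithm may output the schedule \<open>x\<close> on the instance \<open>I\<close>, for some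
  optimal LP solution and some way of breaking ties.\<close>

definition list_scheduling :: "'k coflow_instance \<Rightarrow> 'k schedule \<Rightarrow> bool" where
  "list_scheduling I x \<longleftrightarrow>
     (\<exists>C segs. lp_optimal I C \<and>
        list_run I C (Min (release I ` coflows I)) (flow_demand I) segs \<and> x = schedule_of segs)"


section \<open>Approximation ratio\<close>

text \<open>A nondeterministic algorithm is a relation between instances and schedules.  On every
  instance of the class \<open>P\<close> it must produce a schedule, and each schedule it may produce must be
  feasible and within the factor \<open>\<alpha> I\<close> of the optimum.\<close>

definition approx_ratio_at_most ::
    "('k coflow_instance \<Rightarrow> bool) \<Rightarrow> ('k coflow_instance \<Rightarrow> 'k schedule \<Rightarrow> bool) \<Rightarrow>
     ('k coflow_instance \<Rightarrow> real) \<Rightarrow> bool" where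
  "approx_ratio_at_most P alg \<alpha> \<longleftrightarrow>
     (\<forall>I. P I \<longrightarrow> (\<exists>x. alg I x) \<and> (\<forall>x. alg I x \<longrightarrow> feasible I x \<and> cost I x \<le> \<alpha> I * opt I))"

end

theory Submission
  imports Defs
begin

text \<open>The completion times of any feasible schedule form a feasible LP solution, so the LP value
  is a lower bound on the optimum.  Once a flow \<open>(i, j, k)\<close> is ready, at every time
  until its completion port \<open>i\<close> or port \<open>j\<close> transmits a flow of a coflow \<open>m\<close> with
  \<open>C m \<le> C k\<close>.  The load inequalities of the LP bound the total load of these coflows on either
  port by \<open>2 * C k\<close>, so the flow completes at most \<open>4 * C k\<close> after it became ready.  Summing
  over a precedence chain of at most \<open>\<mu>\<close> coflows, along which \<open>C\<close> is monotone, gives \<open>4 * \<mu> * C k\<close>.\<close>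

section \<open>Instances with zero release times\<close>

text \<open>With all releases at zero, an incomplete flow waits only for its predecessors or for a
  port, so time after readiness can be charged entirely to port load. The factor 4 is 2 for each of
  the two ports. The competing schedules have arbitrary integrable rates with preemption, so
  completion times are infima and work is an integral; the optimum and the output of the algorithm
  are treated by the same facts about feasible schedules. The ratio statement also requires that the
  algorithm outputs something. This needs termination of the rounds and a minimum of the LP that is
  attained, although the LP region is unbounded. Coflows without flows complete as soon as all their
  ancestors do. They transmit nothing but still pass waiting on to their successors, so readiness is
  expressed by flows of coflows related by the transitive closure, and these closure steps are later
  refined into edges of a path.\<close>

text \<open>The selector \<open>q\<close> stands for \<open>inp\<close> or \<open>outp\<close>, so
  every argument about a port is made once for both sides. Summing over flows instead of opposite
  ports matches the capacity constraints of \<open>feasible\<close>.\<close>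

definition port_load :: "'k coflow_instance \<Rightarrow> ('k flow \<Rightarrow> nat) \<Rightarrow> nat \<Rightarrow> 'k \<Rightarrow> real" where
  "port_load I q i k = (\<Sum>f | f \<in> flows I \<and> q f = i \<and> cofl f = k. flow_demand I f)"

locale zero_release =
  fixes I :: "'k coflow_instance"
  assumes valid: "valid_instance I"
    and release_0: "k \<in> coflows I \<Longrightarrow> release I k = 0"
begin

lemma finite_coflows [simp]: "finite (coflows I)"
  using valid by (simp add: valid_instance_def)

lemma prec_subset: "prec I \<subseteq> coflows I \<times> coflows I"
  using valid by (simp add: valid_instance_def)

lemma acyclic_prec: "acyclic (prec I)"
  using valid by (simp add: valid_instance_def)

lemma wf_prec: "wf (prec I)"
  using prec_subset acyclic_prec by (meson finite_SigmaI finite_acyclic_wf finite_coflows finite_subset)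

lemma trancl_prec_subset: "(prec I)\<^sup>+ \<subseteq> coflows I \<times> coflows I"
  using prec_subset by (rule trancl_subset_Sigma)

lemma weight_nonneg: "k \<in> coflows I \<Longrightarrow> 0 \<le> weight I k"
  using valid by (simp add: valid_instance_def)

lemma finite_flows [simp]: "finite (flows I)"
proof (rule finite_subset)
  show "flows I \<subseteq> {1..ports I} \<times> {1..ports I} \<times> coflows I"
    by (auto simp: flows_def)
qed auto

lemma cofl_in_coflows: "f \<in> flows I \<Longrightarrow> cofl f \<in> coflows I"
  by (auto simp: flows_def cofl_def)

lemma inp_in_ports: "f \<in> flows I \<Longrightarrow> inp f \<in> {1..ports I}"
  and outp_in_ports: "f \<in> flows I \<Longrightarrow> outp f \<in> {1..ports I}"
  by (auto simp: flows_def inp_def outp_def)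

lemma flow_demand_pos: "f \<in> flows I \<Longrightarrow> 0 < flow_demand I f"
  by (auto simp: flows_def flow_demand_def inp_def outp_def cofl_def)

lemma finite_flows_of [simp]: "finite (flows_of I k)"
  by (simp add: flows_of_def)

lemma port_load_nonneg: "0 \<le> port_load I q i k"
  unfolding port_load_def by (rule sum_nonneg) (auto simp: flow_demand_def)

lemma in_load_eq:
  assumes "i \<in> {1..ports I}" "k \<in> coflows I"
  shows "in_load I i k = port_load I inp i k"
proof -
  have "in_load I i k = (\<Sum>j | j \<in> {1..ports I} \<and> 0 < demand I i j k. real (demand I i j k))"
    unfolding in_load_def by (rule sum.mono_neutral_right) auto
  also have "\<dots> = port_load I inp i k"
    unfolding port_load_def
    by (rule sum.reindex_bij_witness[of _ outp "\<lambda>j. (i, j, k)"])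
      (use assms in \<open>auto simp: flows_def inp_def outp_def cofl_def flow_demand_def\<close>)
  finally show ?thesis .
qed

lemma out_load_eq:
  assumes "j \<in> {1..ports I}" "k \<in> coflows I"
  shows "out_load I j k = port_load I outp j k"
proof -
  have "out_load I j k = (\<Sum>i | i \<in> {1..ports I} \<and> 0 < demand I i j k. real (demand I i j k))"
    unfolding out_load_def by (rule sum.mono_neutral_right) auto
  also have "\<dots> = port_load I outp j k"
    unfolding port_load_def
    by (rule sum.reindex_bij_witness[of _ inp "\<lambda>i. (i, j, k)"])
      (use assms in \<open>auto simp: flows_def inp_def outp_def cofl_def flow_demand_def\<close>)
  finally show ?thesis .
qed

lemma sum_port_load:
  assumes "S \<subseteq> coflows I"
  shows "(\<Sum>k\<in>S. port_load I q i k) = (\<Sum>f | f \<in> flows I \<and> q f = i \<and> cofl f \<in> S. flow_demand I f)"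
proof -
  have "finite S" using assms finite_coflows by (rule finite_subset)
  then have "(\<Sum>k\<in>S. \<Sum>f | f \<in> {f \<in> flows I. q f = i \<and> cofl f \<in> S} \<and> cofl f = k. flow_demand I f)
      = (\<Sum>f | f \<in> flows I \<and> q f = i \<and> cofl f \<in> S. flow_demand I f)"
    by (intro sum.group) auto
  moreover have "port_load I q i k
      = (\<Sum>f | f \<in> {f \<in> flows I. q f = i \<and> cofl f \<in> S} \<and> cofl f = k. flow_demand I f)"
    if "k \<in> S" for k
    unfolding port_load_def using that by (intro sum.cong) auto
  ultimately show ?thesis by simp
qed

text \<open>Zero releases and the uniform load turn the six constraint families into three,
  quantified over the side \<open>q\<close> of the network.\<close>

lemma lp_feasible_iff:
  "lp_feasible I C \<longleftrightarrow>
     (\<forall>q\<in>{inp, outp}. \<forall>i\<in>{1..ports I}.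
        (\<forall>k\<in>coflows I. port_load I q i k \<le> C k) \<and>
        (\<forall>(k', k)\<in>prec I. C k' + port_load I q i k \<le> C k) \<and>
        (\<forall>S\<subseteq>coflows I. 1/2 * ((\<Sum>k\<in>S. (port_load I q i k)\<^sup>2) + (\<Sum>k\<in>S. port_load I q i k)\<^sup>2)
           \<le> (\<Sum>k\<in>S. port_load I q i k * C k)))"
proof -
  \<comment> \<open>The two loads agree only for genuine ports and coflows, so rewriting under the
    sum needs a congruence. The abstract \<open>F\<close> covers the products, the squares and the
    plain loads at once.\<close>
  have in_sum: "(\<Sum>k\<in>S. F (in_load I i k) k) = (\<Sum>k\<in>S. F (port_load I inp i k) k)"
    if "S \<subseteq> coflows I" "i \<in> {1..ports I}" for S i and F :: "real \<Rightarrow> 'k \<Rightarrow> real"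
    using that by (intro sum.cong refl) (simp add: in_load_eq subset_iff)
  have out_sum: "(\<Sum>k\<in>S. F (out_load I i k) k) = (\<Sum>k\<in>S. F (port_load I outp i k) k)"
    if "S \<subseteq> coflows I" "i \<in> {1..ports I}" for S i and F :: "real \<Rightarrow> 'k \<Rightarrow> real"
    using that by (intro sum.cong refl) (simp add: out_load_eq subset_iff)
  have in_prec: "k' \<in> coflows I" "k \<in> coflows I" if "(k', k) \<in> prec I" for k' k
    using that prec_subset by auto
  have 1: "(\<forall>k\<in>coflows I. \<forall>i\<in>{1..ports I}. C k \<ge> release I k + in_load I i k) \<longleftrightarrow>
     (\<forall>i\<in>{1..ports I}. \<forall>k\<in>coflows I. port_load I inp i k \<le> C k)"
    by (auto simp: release_0 in_load_eq)
  have 2: "(\<forall>k\<in>coflows I. \<forall>i\<in>{1..ports I}. C k \<ge> release I k + out_load I i k) \<longleftrightarrow>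
     (\<forall>i\<in>{1..ports I}. \<forall>k\<in>coflows I. port_load I outp i k \<le> C k)"
    by (auto simp: release_0 out_load_eq)
  have 3: "(\<forall>(k', k)\<in>prec I. \<forall>i\<in>{1..ports I}. C k \<ge> C k' + in_load I i k) \<longleftrightarrow>
     (\<forall>i\<in>{1..ports I}. \<forall>(k', k)\<in>prec I. C k' + port_load I inp i k \<le> C k)"
    by (fastforce simp: in_prec in_load_eq)
  have 4: "(\<forall>(k', k)\<in>prec I. \<forall>i\<in>{1..ports I}. C k \<ge> C k' + out_load I i k) \<longleftrightarrow>
     (\<forall>i\<in>{1..ports I}. \<forall>(k', k)\<in>prec I. C k' + port_load I outp i k \<le> C k)"
    by (fastforce simp: in_prec out_load_eq)
  have 5: "(\<forall>i\<in>{1..ports I}. \<forall>S\<subseteq>coflows I.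
        (\<Sum>k\<in>S. in_load I i k * C k)
          \<ge> 1/2 * ((\<Sum>k\<in>S. (in_load I i k)\<^sup>2) + (\<Sum>k\<in>S. in_load I i k)\<^sup>2)) \<longleftrightarrow>
     (\<forall>i\<in>{1..ports I}. \<forall>S\<subseteq>coflows I. 1/2 * ((\<Sum>k\<in>S. (port_load I inp i k)\<^sup>2) + (\<Sum>k\<in>S. port_load I inp i k)\<^sup>2)
           \<le> (\<Sum>k\<in>S. port_load I inp i k * C k))"
    by (intro ball_cong all_cong refl)
      (simp add: in_sum[where F = "\<lambda>l k. l * C k"] in_sum[where F = "\<lambda>l k. l\<^sup>2"] in_sum[where F = "\<lambda>l k. l"])
  have 6: "(\<forall>i\<in>{1..ports I}. \<forall>S\<subseteq>coflows I.
        (\<Sum>k\<in>S. out_load I i k * C k)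
          \<ge> 1/2 * ((\<Sum>k\<in>S. (out_load I i k)\<^sup>2) + (\<Sum>k\<in>S. out_load I i k)\<^sup>2)) \<longleftrightarrow>
     (\<forall>i\<in>{1..ports I}. \<forall>S\<subseteq>coflows I. 1/2 * ((\<Sum>k\<in>S. (port_load I outp i k)\<^sup>2) + (\<Sum>k\<in>S. port_load I outp i k)\<^sup>2)
           \<le> (\<Sum>k\<in>S. port_load I outp i k * C k))"
    by (intro ball_cong all_cong refl)
      (simp add: out_sum[where F = "\<lambda>l k. l * C k"] out_sum[where F = "\<lambda>l k. l\<^sup>2"] out_sum[where F = "\<lambda>l k. l"])
  show ?thesis
    unfolding lp_feasible_def 1 2 3 4 5 6 by (simp only: ball_simps ball_conj_distrib conj_ac simp_thms)
qed

end

section \<open>The greedy matching\<close>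

lemma greedy_append: "greedy (fs @ [f]) =
   (if link_idle (greedy fs) f then insert f (greedy fs) else greedy fs)"
  by (simp add: greedy_def)

lemma greedy_subset: "greedy fs \<subseteq> set fs"
proof (induction fs rule: rev_induct)
  case Nil
  then show ?case by (simp add: greedy_def)
next
  case (snoc f fs)
  then show ?case by (auto simp: greedy_append)
qed

lemma greedy_matching:
  "\<lbrakk>f \<in> greedy fs; g \<in> greedy fs; inp f = inp g \<or> outp f = outp g\<rbrakk> \<Longrightarrow> f = g"
proof (induction fs rule: rev_induct)
  case Nil
  then show ?case by (simp add: greedy_def)
next
  case (snoc h fs)
  then show ?case by (fastforce simp: greedy_append link_idle_def split: if_splits)
qed

text \<open>A listed flow is either selected, and is then its own witness, or finds its link
  occupied by a flow examined earlier, whose key is no larger because the list is sorted.\<close>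

lemma greedy_blocking:
  "\<lbrakk>sorted (map p fs); f \<in> set fs\<rbrakk> \<Longrightarrow>
   \<exists>g\<in>greedy fs. p g \<le> p f \<and> (inp g = inp f \<or> outp g = outp f)"
proof (induction fs rule: rev_induct)
  case Nil
  then show ?case by simp
next
  case (snoc h fs)
  show ?case
  proof (cases "f \<in> set fs")
    case True
    with snoc show ?thesis by (fastforce simp: greedy_append sorted_append)
  next
    case False
    with snoc.prems have [simp]: "f = h" by simp
    show ?thesis
    proof (cases "link_idle (greedy fs) h")
      case True
      then show ?thesis by (auto simp: greedy_append)
    next
      case False
      then obtain g where "g \<in> greedy fs" "inp g = inp h \<or> outp g = outp h"
        by (auto simp: link_idle_def)
      moreover from this have "p g \<le> p h"
        using greedy_subset[of fs] snoc.prems by (auto simp: sorted_append)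
      ultimately show ?thesis using False by (auto simp: greedy_append)
    qed
  qed
qed

section \<open>Runs of the algorithm\<close>

context zero_release
begin

lemma eligible_eq: "0 \<le> t \<Longrightarrow> eligible I t rem =
   {f \<in> flows I. 0 < rem f \<and> (\<forall>g\<in>flows I. (cofl g, cofl f) \<in> (prec I)\<^sup>+ \<longrightarrow> rem g \<le> 0)}"
  using trancl_prec_subset
  by (fastforce simp: eligible_def flows_of_def release_0 cofl_in_coflows)

text \<open>Among the incomplete flows, take one whose coflow is minimal in the well-founded
  precedence order: nothing before it is incomplete.\<close>

lemma eligible_nonempty:
  assumes "0 \<le> t" "f \<in> flows I" "0 < rem f"
  shows "eligible I t rem \<noteq> {}"
proof -
  have "wf (inv_image ((prec I)\<^sup>+) cofl)"
    by (intro wf_inv_image wf_trancl wf_prec)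
  moreover have "f \<in> {f \<in> flows I. 0 < rem f}" using assms by simp
  ultimately obtain g where g: "g \<in> {f \<in> flows I. 0 < rem f}"
    and min: "\<And>h. (h, g) \<in> inv_image ((prec I)\<^sup>+) cofl \<Longrightarrow> h \<notin> {f \<in> flows I. 0 < rem f}"
    by (rule wfE_min) blast
  then have "g \<in> eligible I t rem" using assms(1) by (force simp: eligible_eq)
  then show ?thesis by blast
qed

lemma next_event_eq: "0 \<le> t \<Longrightarrow> next_event I t rem A = Min ((\<lambda>f. t + rem f) ` A)"
proof -
  assume "0 \<le> t"
  then have "{release I k | k. k \<in> coflows I \<and> t < release I k} = {}"
    by (auto simp: release_0)
  then show ?thesis unfolding next_event_def by (simp only: Un_empty_right)
qed

text \<open>There are no future releases, so the next event is the completion of some transmitted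
  flow. Hence every round has positive length and finishes a flow.\<close>

lemma round_facts:
  assumes "0 \<le> t" "\<exists>f\<in>flows I. 0 < rem f" "set fs = eligible I t rem" "A = greedy fs"
    "t' = next_event I t rem A"
  shows "A \<subseteq> flows I" "t < t'" "\<And>f. f \<in> A \<Longrightarrow> 0 < rem f" "\<And>f. f \<in> A \<Longrightarrow> t' \<le> t + rem f"
    "\<exists>f\<in>A. t' = t + rem f"
proof -
  have sub: "A \<subseteq> eligible I t rem" using assms greedy_subset by metis
  then show flows: "A \<subseteq> flows I" by (auto simp: eligible_def)
  then have fin: "finite A" using finite_flows by (rule finite_subset)
  show pos: "0 < rem f" if "f \<in> A" for f using sub that by (auto simp: eligible_def)
  have "eligible I t rem \<noteq> {}" using assms eligible_nonempty by blast
  then obtain f where "f \<in> set fs" using assms(3) by auto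
  \<comment> \<open>A constant key makes every list sorted, so \<open>greedy_blocking\<close> yields
    nonemptiness without reference to priorities.\<close>
  then have "A \<noteq> {}"
    using greedy_blocking[of "\<lambda>_. 0 :: real" fs f] assms(4) by (auto simp: sorted_map map_replicate_const)
  then have in_A: "t' \<in> (\<lambda>f. t + rem f) ` A"
    using assms fin by (simp add: next_event_eq)
  then show "\<exists>f\<in>A. t' = t + rem f" by auto
  show "t < t'" using in_A pos by auto
  show "t' \<le> t + rem f" if "f \<in> A" for f
    using that fin assms by (simp add: next_event_eq)
qed

text \<open>Termination measure: the number of incomplete flows, which drops in each round since one
  flow finishes and none gains remaining data.\<close>

lemma list_run_exists: "0 \<le> t \<Longrightarrow> \<exists>segs. list_run I C t rem segs"
proof (induction "card {f \<in> flows I. 0 < rem f}" arbitrary: t rem rule: less_induct)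
  case less
  show ?case
  proof (cases "\<exists>f\<in>flows I. 0 < rem f")
    case False
    then show ?thesis by (meson finished not_less)
  next
    case True
    have "finite (eligible I t rem)" by (simp add: eligible_def)
    then obtain fs0 where fs0: "set fs0 = eligible I t rem" "distinct fs0"
      using finite_distinct_list by blast
    define fs where "fs = sort_key (\<lambda>f. C (cofl f)) fs0"
    have fs: "set fs = eligible I t rem" "distinct fs" "sorted (map (\<lambda>f. C (cofl f)) fs)"
      by (simp_all add: fs_def fs0)
    define A where "A = greedy fs"
    define t' where "t' = next_event I t rem A"
    define rem' where "rem' = (\<lambda>f. if f \<in> A then rem f - (t' - t) else rem f)"
    note facts = round_facts[OF less.prems True fs(1) A_def t'_def]
    have "{f \<in> flows I. 0 < rem' f} \<subset> {f \<in> flows I. 0 < rem f}"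
    proof
      show "{f \<in> flows I. 0 < rem' f} \<subseteq> {f \<in> flows I. 0 < rem f}"
        using facts(2) by (auto simp: rem'_def split: if_splits)
      obtain f where "f \<in> A" "t' = t + rem f" using facts(5) by blast
      then have "f \<in> {f \<in> flows I. 0 < rem f} - {f \<in> flows I. 0 < rem' f}"
        using facts(1,3) by (auto simp: rem'_def)
      then show "{f \<in> flows I. 0 < rem' f} \<noteq> {f \<in> flows I. 0 < rem f}" by blast
    qed
    then have "card {f \<in> flows I. 0 < rem' f} < card {f \<in> flows I. 0 < rem f}"
      by (intro psubset_card_mono) auto
    then obtain segs where "list_run I C t' rem' segs"
      using less.hyps[of rem' t'] less.prems facts(2) by auto
    then have "list_run I C t rem ((t, t', A) # segs)"
      unfolding rem'_def by (intro round[OF True fs(2,1,3) A_def t'_def])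
    then show ?thesis by blast
  qed
qed

end

section \<open>The schedule of a run as a function of time\<close>

lemma schedule_of_Nil: "schedule_of [] f u = 0"
  by (simp add: schedule_of_def)

lemma schedule_of_Cons: "schedule_of ((s, e, A) # segs) f u =
   (if s \<le> u \<and> u < e \<and> f \<in> A then 1 else schedule_of segs f u)"
  by (auto simp: schedule_of_def)

lemma schedule_of_01: "schedule_of segs f u = 0 \<or> schedule_of segs f u = 1"
  by (simp add: schedule_of_def)

lemma has_integral_indicator_Ico:
  fixes s e u :: real
  assumes "0 \<le> s" "s \<le> e" "0 \<le> u"
  shows "((\<lambda>v. if s \<le> v \<and> v < e then 1 else 0) has_integral min u e - min u s) {0..u}"
proof -
  have "((\<lambda>v. 1 :: real) has_integral min u e - min u s) {min u s..min u e}"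
    using has_integral_const_real[of "1 :: real" "min u s" "min u e"] min.mono[OF order_refl assms(2)]
    by (simp del: min.bounded_iff)
  then have "((\<lambda>v. if v \<in> {min u s..min u e} then 1 :: real else 0) has_integral min u e - min u s) {0..u}"
    by (subst has_integral_restrict) (use assms in auto)
  \<comment> \<open>The closed and the half-open indicator differ at most at \<open>e\<close>, when
    the interval ends by \<open>u\<close>, or at \<open>u\<close>, when \<open>u\<close> lies before
    \<open>s\<close> and the closed interval degenerates to a point.\<close>
  then show ?thesis
    by (rule has_integral_spike_finite[where S = "{e, u}", rotated 2]) (auto simp: min_def)
qed

text \<open>Invariant for runs from an arbitrary state: \<open>rem\<close> plays the part of the
  demand, which lets the induction treat the tail of a run like a whole run. The last conjunct
  extends the greedy choice from event times to all times: within a round no new flow becomes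
  ready.\<close>

lemma (in zero_release) list_run_schedule:
  assumes "list_run I C t rem segs" "0 \<le> t" "\<forall>f\<in>flows I. 0 \<le> rem f"
  defines "x \<equiv> schedule_of segs"
  shows "(\<forall>f. \<forall>u<t. x f u = 0) \<and>
    (\<forall>f. \<forall>u\<ge>0. x f integrable_on {0..u}) \<and>
    (\<forall>f\<in>flows I. (\<forall>u\<ge>0. sent x f u \<le> rem f) \<and> (\<exists>u\<ge>0. sent x f u = rem f)) \<and>
    (\<forall>u. \<forall>f g. x f u \<noteq> 0 \<longrightarrow> x g u \<noteq> 0 \<longrightarrow> inp f = inp g \<or> outp f = outp g \<longrightarrow> f = g) \<and>
    (\<forall>u. \<forall>f. x f u \<noteq> 0 \<longrightarrow> (\<forall>g\<in>flows I. (cofl g, cofl f) \<in> (prec I)\<^sup>+ \<longrightarrow> rem g \<le> sent x g u)) \<and>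
    (\<forall>u\<ge>t. \<forall>f\<in>flows I. sent x f u < rem f \<longrightarrow>
       (\<forall>g\<in>flows I. (cofl g, cofl f) \<in> (prec I)\<^sup>+ \<longrightarrow> rem g \<le> sent x g u) \<longrightarrow>
       (\<exists>g\<in>flows I. x g u = 1 \<and> C (cofl g) \<le> C (cofl f) \<and> (inp g = inp f \<or> outp g = outp f)))"
  using assms(1-3) unfolding x_def
proof (induction rule: list_run.induct)
  case (finished rem t)
  have [simp]: "(schedule_of [] :: 'k schedule) = (\<lambda>f u. 0)"
    by (intro ext) (rule schedule_of_Nil)
  have [simp]: "sent (\<lambda>f u. 0) f u = 0" for f :: "'k flow" and u
    by (simp add: sent_def)
  have [simp]: "rem f = 0" if "f \<in> flows I" for f
    using finished that by (meson antisym)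
  show ?case by auto
next
  case (round rem fs t A t' segs)
  let ?rem = "\<lambda>f. if f \<in> A then rem f - (t' - t) else rem f"
  let ?x = "schedule_of segs"
  let ?y = "schedule_of ((t, t', A) # segs)"
  note facts = round_facts[OF round.prems(1) round.hyps(1,3,5,6)]
  have nonneg: "\<forall>f\<in>flows I. 0 \<le> ?rem f"
    using facts(4) round.prems(2) by fastforce
  have t': "0 \<le> t'" using facts(2) round.prems(1) by simp
  note IH = round.IH[OF t' nonneg]
  have x_early: "?x f u = 0" if "u < t'" for f u
    using IH that by blast
  have x_int: "?x f integrable_on {0..u}" if "0 \<le> u" for f u
    using IH that by blast
  have x_le: "sent ?x f u \<le> ?rem f" if "0 \<le> u" "f \<in> flows I" for f u
    using IH that by blast
  have x_ex: "\<exists>u\<ge>0. sent ?x f u = ?rem f" if "f \<in> flows I" for f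
    using IH that by blast
  have x_match: "f = g" if "?x f u \<noteq> 0" "?x g u \<noteq> 0" "inp f = inp g \<or> outp f = outp g" for f g u
    using IH that by blast
  have x_prec: "?rem g \<le> sent ?x g u" if "?x f u \<noteq> 0" "g \<in> flows I" "(cofl g, cofl f) \<in> (prec I)\<^sup>+" for f g u
    using IH that by blast
  have x_busy: "\<exists>g\<in>flows I. ?x g u = 1 \<and> C (cofl g) \<le> C (cofl f) \<and> (inp g = inp f \<or> outp g = outp f)"
    if "t' \<le> u" "f \<in> flows I" "sent ?x f u < ?rem f"
      "\<And>g. g \<in> flows I \<Longrightarrow> (cofl g, cofl f) \<in> (prec I)\<^sup>+ \<Longrightarrow> ?rem g \<le> sent ?x g u" for f u
    using IH that by blast
  \<comment> \<open>The tail is silent before \<open>t'\<close>, so the first round and the tail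
    never overlap and their rates simply add.\<close>
  have y_eq: "?y f u = (if f \<in> A \<and> t \<le> u \<and> u < t' then 1 else 0) + ?x f u" for f u
    using x_early[of u f] by (auto simp: schedule_of_Cons)
  have y_has_integral: "(?y f has_integral (if f \<in> A then min u t' - min u t else 0) + sent ?x f u) {0..u}"
    if u: "0 \<le> u" for f u
  proof -
    have 1: "((\<lambda>v. if f \<in> A \<and> t \<le> v \<and> v < t' then 1 else 0)
        has_integral (if f \<in> A then min u t' - min u t else 0)) {0..u}"
      using has_integral_indicator_Ico[of t t' u] round.prems(1) facts(2) u
      by (cases "f \<in> A") auto
    have 2: "(?x f has_integral sent ?x f u) {0..u}"
      unfolding sent_def using x_int[OF u] by (rule integrable_integral)
    show ?thesis using has_integral_add[OF 1 2] by (simp add: y_eq[abs_def])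
  qed
  have sent_y: "sent ?y f u = (if f \<in> A then min u t' - min u t else 0) + sent ?x f u" if "0 \<le> u" for f u
    using integral_unique[OF y_has_integral[OF that]] by (simp add: sent_def)
  have sent_x_early: "sent ?x f u = 0" if "u < t'" for f u
  proof -
    have "integral {0..u} (?x f) = integral {0..u} (\<lambda>_. 0)"
      by (rule Henstock_Kurzweil_Integration.integral_cong) (use that x_early in auto)
    then show ?thesis by (simp add: sent_def)
  qed
  \<comment> \<open>By \<open>t'\<close> each flow in \<open>A\<close> has received exactly the
    amount \<open>t' - t\<close> by which its remaining data was reduced, so completeness means the
    same in both states.\<close>
  have sent_y_late: "rem f \<le> sent ?y f u \<longleftrightarrow> ?rem f \<le> sent ?x f u"
    "sent ?y f u < rem f \<longleftrightarrow> sent ?x f u < ?rem f" if "t' \<le> u" for f u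
    using that t' facts(2) by (auto simp: sent_y)
  have eligible: "eligible I t rem = {f \<in> flows I. 0 < rem f \<and> (\<forall>g\<in>flows I. (cofl g, cofl f) \<in> (prec I)\<^sup>+ \<longrightarrow> rem g \<le> 0)}"
    using round.prems(1) by (rule eligible_eq)
  have sub: "A \<subseteq> eligible I t rem" using greedy_subset round.hyps(3,5) by metis
  have y_late: "?y f u = ?x f u" if "t' \<le> u" for f u using that by (simp add: y_eq)
  have y_head: "?y f u = (if f \<in> A then 1 else 0)" if "t \<le> u" "u < t'" for f u
    using that x_early by (simp add: y_eq)
  have y_early: "?y f u = 0" if "u < t" for f u
    using that x_early facts(2) by (simp add: y_eq)
  have c: "f = g" if "?y f u \<noteq> 0" "?y g u \<noteq> 0" "inp f = inp g \<or> outp f = outp g" for f g u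
  proof -
    consider "u < t" | "t \<le> u" "u < t'" | "t' \<le> u" by linarith
    then show ?thesis
    proof cases
      case 1 then show ?thesis using that y_early by simp
    next
      case 2
      then have "f \<in> A" "g \<in> A" using that(1,2) by (auto simp: y_head split: if_splits)
      then show ?thesis using that(3) greedy_matching round.hyps(5) by blast
    next
      case 3 then show ?thesis using that x_match[of f u g] unfolding y_late[OF 3] by blast
    qed
  qed
  have d: "rem g \<le> sent ?y g u" if "?y f u \<noteq> 0" "g \<in> flows I" "(cofl g, cofl f) \<in> (prec I)\<^sup>+" for f g u
  proof -
    consider "u < t" | "t \<le> u" "u < t'" | "t' \<le> u" by linarith
    then show ?thesis
    proof cases
      case 1 then show ?thesis using that y_early by simp
    next
      case 2
      then have "f \<in> A" using that by (simp add: y_head split: if_splits)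
      then have "rem g \<le> 0" using sub that eligible by auto
      then show ?thesis using 2 round.prems(1) by (simp add: sent_y sent_x_early)
    next
      case 3 then show ?thesis using that x_prec[of f u g] unfolding y_late[OF 3] sent_y_late[OF 3] by blast
    qed
  qed
  have e: "\<exists>g\<in>flows I. ?y g u = 1 \<and> C (cofl g) \<le> C (cofl f) \<and> (inp g = inp f \<or> outp g = outp f)"
    if u: "t \<le> u" and f: "f \<in> flows I" "sent ?y f u < rem f"
      and pr: "\<And>g. g \<in> flows I \<Longrightarrow> (cofl g, cofl f) \<in> (prec I)\<^sup>+ \<Longrightarrow> rem g \<le> sent ?y g u" for f u
  proof (cases "u < t'")
    case True
    have *: "sent ?y g u = (if g \<in> A then u - t else 0)" for g
      using True u round.prems(1) by (simp add: sent_y sent_x_early)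
    have "0 < rem f" using f(2) u by (auto simp: * split: if_splits)
    \<comment> \<open>A predecessor in \<open>A\<close> would have sent only \<open>u - t\<close>,
      less than \<open>t' - t\<close> and thus less than \<open>rem g\<close>; outside
      \<open>A\<close> it has sent nothing. So it was already complete at \<open>t\<close>.\<close>
    moreover have "rem g \<le> 0" if "g \<in> flows I" "(cofl g, cofl f) \<in> (prec I)\<^sup>+" for g
      using pr[OF that] facts(4)[of g] True by (auto simp: * split: if_splits)
    ultimately have "f \<in> set fs" using f(1) round.hyps(3) eligible by simp
    then obtain g where "g \<in> A" "C (cofl g) \<le> C (cofl f)" "inp g = inp f \<or> outp g = outp f"
      using greedy_blocking[OF round.hyps(4)] round.hyps(5) by blast
    then show ?thesis using facts(1) True u by (intro bexI[of _ g]) (auto simp: y_head)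
  next
    case False
    then have u': "t' \<le> u" by simp
    show ?thesis
      using x_busy[OF u' f(1)] f(2) pr unfolding sent_y_late[OF u'] y_late[OF u'] by blast
  qed
  have b1: "sent ?y f u \<le> rem f" if "0 \<le> u" "f \<in> flows I" for f u
  proof (cases "u < t'")
    case True
    then show ?thesis
      using that facts(4)[of f] round.prems by (auto simp: sent_y sent_x_early min_def)
  next
    case False
    then have "sent ?y f u = (if f \<in> A then t' - t else 0) + sent ?x f u"
      using that facts(2) by (simp add: sent_y)
    then show ?thesis using x_le[OF that] by (auto split: if_splits)
  qed
  have b2: "\<exists>u\<ge>0. sent ?y f u = rem f" if f: "f \<in> flows I" for f
  proof -
    obtain u where u: "0 \<le> u" "sent ?x f u = ?rem f" using x_ex[OF f] by blast
    show ?thesis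
    proof (cases "u < t'")
      case False
      then show ?thesis using u facts(2) by (intro exI[of _ u]) (auto simp: sent_y)
    next
      case True
      \<comment> \<open>Here the tail has nothing left to send for \<open>f\<close>, but the first
        round may still be delivering at \<open>u\<close>; the witness is therefore
        \<open>t'\<close>. The tail may be active at the single point \<open>t'\<close>, beyond the
        reach of \<open>sent_x_early\<close>.\<close>
      have [simp]: "sent ?x f t' = 0"
      proof -
        have "integral {0..t'} (?x f) = integral {0..t'} (\<lambda>_. 0)"
          by (rule integral_spike[of "{t'}"]) (use x_early in auto)
        then show ?thesis by (simp add: sent_def)
      qed
      show ?thesis
        using u True facts(2) t' by (intro exI[of _ t']) (auto simp: sent_y sent_x_early)
    qed
  qed
  have b3: "?y f integrable_on {0..u}" if "0 \<le> u" for f u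
    using y_has_integral[OF that] by (rule has_integral_integrable)
  show ?case
  proof (intro conjI)
    show "\<forall>f. \<forall>u<t. ?y f u = 0" using y_early by blast
    show "\<forall>f. \<forall>u\<ge>0. ?y f integrable_on {0..u}" using b3 by blast
    show "\<forall>f\<in>flows I. (\<forall>u\<ge>0. sent ?y f u \<le> rem f) \<and> (\<exists>u\<ge>0. sent ?y f u = rem f)"
      using b1 b2 by blast
    show "\<forall>u f g. ?y f u \<noteq> 0 \<longrightarrow> ?y g u \<noteq> 0 \<longrightarrow> inp f = inp g \<or> outp f = outp g \<longrightarrow> f = g"
      by (intro allI impI) (rule c)
    show "\<forall>u f. ?y f u \<noteq> 0 \<longrightarrow>
        (\<forall>g\<in>flows I. (cofl g, cofl f) \<in> (prec I)\<^sup>+ \<longrightarrow> rem g \<le> sent ?y g u)"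
      by (intro allI impI ballI) (rule d)
    show "\<forall>u\<ge>t. \<forall>f\<in>flows I. sent ?y f u < rem f \<longrightarrow>
       (\<forall>g\<in>flows I. (cofl g, cofl f) \<in> (prec I)\<^sup>+ \<longrightarrow> rem g \<le> sent ?y g u) \<longrightarrow>
       (\<exists>g\<in>flows I. ?y g u = 1 \<and> C (cofl g) \<le> C (cofl f) \<and> (inp g = inp f \<or> outp g = outp f))"
      by (intro allI impI ballI, rule e) simp_all
  qed
qed

section \<open>Feasible schedules yield feasible LP solutions\<close>

text \<open>When \<open>c\<close> are completion times, the hypothesis says that the work done by time \<open>c k\<close> is at most \<open>c k\<close>.\<close>

lemma weighted_completion_bound:
  fixes l c :: "'a \<Rightarrow> real"
  assumes "finite S" "\<And>k. k \<in> S \<Longrightarrow> 0 \<le> l k"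
    and "\<And>k. k \<in> S \<Longrightarrow> (\<Sum>m | m \<in> S \<and> c m \<le> c k. l m) \<le> c k"
  shows "1/2 * ((\<Sum>k\<in>S. (l k)\<^sup>2) + (\<Sum>k\<in>S. l k)\<^sup>2) \<le> (\<Sum>k\<in>S. l k * c k)"
  using assms
proof (induction S rule: finite_ranking_induct[where f = c])
  case empty
  then show ?case by simp
next
  case (insert k S)
  show ?case
  proof (cases "k \<in> S")
    case True
    then show ?thesis using insert by (simp add: insert_absorb)
  next
    case False
    have "(\<Sum>m | m \<in> S \<and> c m \<le> c k'. l m) \<le> c k'" if "k' \<in> S" for k'
    proof -
      have "(\<Sum>m | m \<in> S \<and> c m \<le> c k'. l m) \<le> (\<Sum>m | m \<in> insert k S \<and> c m \<le> c k'. l m)"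
        by (rule sum_mono2) (use insert.hyps insert.prems in auto)
      then show ?thesis using insert.prems(2)[of k'] that by simp
    qed
    then have IH: "1/2 * ((\<Sum>k\<in>S. (l k)\<^sup>2) + (\<Sum>k\<in>S. l k)\<^sup>2) \<le> (\<Sum>k\<in>S. l k * c k)"
      using insert by simp
    \<comment> \<open>The new \<open>k\<close> ranks last, so the hypothesis at \<open>k\<close>
      bounds the whole load. The product \<open>l k * (l k + sum)\<close> is exactly the increment
      of the left-hand side.\<close>
    have "{m. m \<in> insert k S \<and> c m \<le> c k} = insert k S" using insert.hyps by auto
    then have "l k + (\<Sum>k\<in>S. l k) \<le> c k" using insert.prems(2)[of k] insert.hyps False by simp
    then have "l k * (l k + (\<Sum>k\<in>S. l k)) \<le> l k * c k"
      using insert.prems(1)[of k] by (intro mult_left_mono) auto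
    then show ?thesis
      using IH False insert.hyps by (simp add: power2_eq_square algebra_simps)
  qed
qed

locale feasible_schedule = zero_release I for I :: "'k coflow_instance" +
  fixes x :: "'k schedule"
  assumes feasible: "feasible I x"
begin

lemma rate_nonneg: "\<lbrakk>f \<in> flows I; 0 \<le> t\<rbrakk> \<Longrightarrow> 0 \<le> x f t"
  and rate_integrable: "\<lbrakk>f \<in> flows I; 0 \<le> t\<rbrakk> \<Longrightarrow> x f integrable_on {0..t}"
  and sent_le_demand: "\<lbrakk>f \<in> flows I; 0 \<le> t\<rbrakk> \<Longrightarrow> sent x f t \<le> flow_demand I f"
  using feasible by (auto simp: feasible_def)

lemma port_capacity:
  assumes "q \<in> {inp, outp}" "i \<in> {1..ports I}" "0 \<le> t"
  shows "(\<Sum>f | f \<in> flows I \<and> q f = i. x f t) \<le> 1"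
  using feasible assms by (auto simp: feasible_def)

lemma rate_integrable_interval:
  "\<lbrakk>f \<in> flows I; 0 \<le> s; s \<le> t\<rbrakk> \<Longrightarrow> x f integrable_on {s..t}"
  using rate_integrable[of f t] by (rule integrable_subinterval_real) auto

lemma sent_combine:
  assumes "f \<in> flows I" "0 \<le> s" "s \<le> t"
  shows "sent x f t = sent x f s + integral {s..t} (x f)"
  unfolding sent_def
  using Henstock_Kurzweil_Integration.integral_combine[of 0 s t "x f"] assms rate_integrable[of f t] by simp

lemma sent_mono:
  assumes "f \<in> flows I" "0 \<le> s" "s \<le> t"
  shows "sent x f s \<le> sent x f t"
proof -
  have "0 \<le> integral {s..t} (x f)"
    by (rule Henstock_Kurzweil_Integration.integral_nonneg)
      (use assms rate_integrable_interval rate_nonneg in auto)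
  then show ?thesis using sent_combine[OF assms] by simp
qed

lemma sent_0 [simp]: "sent x f 0 = 0"
  by (simp add: sent_def)

lemma sent_nonneg: "\<lbrakk>f \<in> flows I; 0 \<le> t\<rbrakk> \<Longrightarrow> 0 \<le> sent x f t"
  using sent_mono[of f 0 t] by simp

lemma sent_eq_0:
  assumes "\<And>u. \<lbrakk>0 \<le> u; u < s\<rbrakk> \<Longrightarrow> x f u = 0"
  shows "sent x f s = 0"
proof -
  have "integral {0..s} (x f) = integral {0..s} (\<lambda>_. 0)"
    by (rule integral_spike[of "{s}"]) (use assms in auto)
  then show ?thesis by (simp add: sent_def)
qed

text \<open>The infimum is attained: \<open>sent\<close> is an indefinite integral, hence
  continuous, and the time \<open>T\<close> of exact delivery confines the search to the closed set
  \<open>Q\<close>. Afterwards completion times are handled only as inequalities on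
  \<open>sent\<close>.\<close>

lemma flow_completion_facts:
  assumes f: "f \<in> flows I"
  shows "0 \<le> flow_completion I x f"
    and "0 \<le> t \<Longrightarrow> flow_completion I x f \<le> t \<longleftrightarrow> flow_demand I f \<le> sent x f t"
proof -
  define P where "P = {t. 0 \<le> t \<and> flow_demand I f \<le> sent x f t}"
  obtain T where T: "0 \<le> T" "sent x f T = flow_demand I f"
    using feasible f by (auto simp: feasible_def)
  define Q where "Q = {0..T} \<inter> sent x f -` {flow_demand I f..}"
  have "continuous_on {0..T} (sent x f)"
    unfolding sent_def by (rule indefinite_integral_continuous_1[OF rate_integrable[OF f T(1)]])
  then have "closed Q" unfolding Q_def by (intro continuous_closed_preimage) auto
  moreover have "T \<in> Q" using T by (simp add: Q_def)
  moreover have "bdd_below Q" by (auto simp: Q_def)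
  ultimately have "Inf Q \<in> Q" using closed_contains_Inf[of Q] by blast
  then have m: "Inf Q \<in> P" by (simp add: P_def Q_def)
  have least: "Inf Q \<le> t" if "t \<in> P" for t
  proof (cases "t \<le> T")
    case True
    then show ?thesis using that \<open>bdd_below Q\<close> by (intro cInf_lower) (auto simp: P_def Q_def)
  next
    case False
    then show ?thesis using cInf_lower[OF \<open>T \<in> Q\<close> \<open>bdd_below Q\<close>] by simp
  qed
  have "flow_completion I x f = Inf Q"
    unfolding flow_completion_def P_def[symmetric] using m least by (rule cInf_eq_minimum)
  then have min: "flow_completion I x f \<in> P" "\<And>t. t \<in> P \<Longrightarrow> flow_completion I x f \<le> t"
    using m least by auto
  then show "0 \<le> flow_completion I x f" by (simp add: P_def)
  show "flow_completion I x f \<le> t \<longleftrightarrow> flow_demand I f \<le> sent x f t" if "0 \<le> t"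
  proof
    assume "flow_completion I x f \<le> t"
    then show "flow_demand I f \<le> sent x f t"
      using sent_mono[OF f, of "flow_completion I x f" t] min(1) by (simp add: P_def)
  next
    assume "flow_demand I f \<le> sent x f t"
    then show "flow_completion I x f \<le> t" using min(2)[of t] that by (simp add: P_def)
  qed
qed

lemma port_work:
  assumes q: "q \<in> {inp, outp}" and i: "i \<in> {1..ports I}" and F: "F \<subseteq> {f \<in> flows I. q f = i}"
    and st: "0 \<le> s" "s \<le> t"
  shows "(\<Sum>f\<in>F. sent x f t) \<le> (\<Sum>f\<in>F. sent x f s) + (t - s)"
proof -
  have fin: "finite F" using F by (rule finite_subset) simp
  have int: "x f integrable_on {s..t}" if "f \<in> F" for f
    using that F st by (intro rate_integrable_interval) auto
  have "(\<Sum>f\<in>F. integral {s..t} (x f)) = integral {s..t} (\<lambda>u. \<Sum>f\<in>F. x f u)"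
    using fin int by (intro integral_sum[symmetric]) auto
  also have "\<dots> \<le> integral {s..t} (\<lambda>_. 1)"
  proof (rule integral_le)
    show "(\<lambda>u. \<Sum>f\<in>F. x f u) integrable_on {s..t}"
      using fin int by (intro integrable_sum) auto
    show "(\<Sum>f\<in>F. x f u) \<le> 1" if "u \<in> {s..t}" for u
    proof -
      have "(\<Sum>f\<in>F. x f u) \<le> (\<Sum>f | f \<in> flows I \<and> q f = i. x f u)"
        by (rule sum_mono2) (use F that st rate_nonneg in auto)
      also have "\<dots> \<le> 1" using port_capacity[OF q i] that st by simp
      finally show ?thesis .
    qed
  qed auto
  also have "\<dots> = t - s" using st by simp
  finally have "(\<Sum>f\<in>F. integral {s..t} (x f)) \<le> t - s" .
  moreover have "(\<Sum>f\<in>F. sent x f t) = (\<Sum>f\<in>F. sent x f s + integral {s..t} (x f))"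
    using F st by (intro sum.cong sent_combine) auto
  ultimately show ?thesis by (simp add: sum.distrib)
qed

lemma finite_ancestors: "k \<in> coflows I \<Longrightarrow> finite {k'. (k', k) \<in> (prec I)\<^sup>*}"
  by (rule finite_subset[of _ "coflows I"])
    (use trancl_prec_subset in \<open>auto simp: rtrancl_eq_or_trancl\<close>)

lemma coflow_completion_ge: "f \<in> flows I \<Longrightarrow> flow_completion I x f \<le> coflow_completion I x (cofl f)"
proof -
  assume "f \<in> flows I"
  then have "f \<in> flows_of I (cofl f)" by (simp add: flows_of_def)
  then show ?thesis unfolding coflow_completion_def by (subst if_P) (auto intro!: Max_ge)
qed

text \<open>The reflexive closure in the hypothesis serves both branches of the definition: the
  flows of \<open>k\<close> itself, or those of all its ancestors when \<open>k\<close> has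
  none.\<close>

lemma coflow_completion_le:
  assumes k: "k \<in> coflows I" and t: "0 \<le> t"
    and le: "\<And>f. f \<in> flows I \<Longrightarrow> (cofl f, k) \<in> (prec I)\<^sup>* \<Longrightarrow> flow_completion I x f \<le> t"
  shows "coflow_completion I x k \<le> t"
proof (cases "flows_of I k = {}")
  case False
  then show ?thesis using le by (auto simp: coflow_completion_def flows_of_def)
next
  case True
  have "release I k' = 0" if "(k', k) \<in> (prec I)\<^sup>*" for k'
    using that k trancl_prec_subset release_0 by (auto simp: rtrancl_eq_or_trancl)
  then show ?thesis
    using True k t le finite_ancestors[OF k] unfolding coflow_completion_def
    by (subst if_not_P, simp, subst Max_le_iff) (auto intro: trancl_into_rtrancl le)
qed

lemma ancestor_completion_le_empty:
  assumes "k \<in> coflows I" "flows_of I k = {}" "f \<in> flows I" "(cofl f, k) \<in> (prec I)\<^sup>+"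
  shows "flow_completion I x f \<le> coflow_completion I x k"
  using assms finite_ancestors[of k] by (auto simp: coflow_completion_def intro!: Max_ge)

lemma coflow_completion_nonneg:
  assumes "k \<in> coflows I"
  shows "0 \<le> coflow_completion I x k"
proof (cases "flows_of I k = {}")
  case False
  then obtain f where "f \<in> flows I" "cofl f = k" by (auto simp: flows_of_def)
  then show ?thesis using flow_completion_facts(1)[of f] coflow_completion_ge[of f] by simp
next
  case True
  have "release I k \<le> coflow_completion I x k"
    using True assms finite_ancestors[of k] by (auto simp: coflow_completion_def intro!: Max_ge)
  then show ?thesis using assms by (simp add: release_0)
qed

text \<open>A positive rate at \<open>u\<close> forces all ancestor flows to be complete by
  \<open>u\<close>. This bounds the completion of \<open>k'\<close> even if \<open>k'\<close> has no
  flow and only its own ancestors determine it.\<close>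

lemma idle_before_predecessor:
  assumes "(k', cofl f) \<in> prec I" "f \<in> flows I" "0 \<le> u" "u < coflow_completion I x k'"
  shows "x f u = 0"
proof (rule ccontr)
  assume "x f u \<noteq> 0"
  then have "0 < x f u" using rate_nonneg[of f u] assms by simp
  then have "flow_completion I x g \<le> u" if "g \<in> flows I" "(cofl g, cofl f) \<in> (prec I)\<^sup>+" for g
    using feasible assms(2,3) that unfolding feasible_def flows_of_def by blast
  then have "coflow_completion I x k' \<le> u"
    using assms prec_subset by (intro coflow_completion_le) (auto intro: rtrancl_into_trancl1)
  then show False using assms by simp
qed

text \<open>If \<open>k\<close> has no flow, its completion time dominates all ancestor flows by
  definition. Otherwise a flow of \<open>k\<close> has positive demand and has sent nothing when
  \<open>k'\<close> completes, so it finishes later.\<close>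

lemma coflow_completion_prec:
  assumes "(k', k) \<in> prec I"
  shows "coflow_completion I x k' \<le> coflow_completion I x k"
proof -
  have k: "k' \<in> coflows I" "k \<in> coflows I" using assms prec_subset by auto
  show ?thesis
  proof (cases "flows_of I k = {}")
    case True
    then show ?thesis
      using k coflow_completion_nonneg assms
      by (intro coflow_completion_le ancestor_completion_le_empty) (auto intro: rtrancl_into_trancl1)
  next
    case False
    then obtain f where f: "f \<in> flows I" "cofl f = k" by (auto simp: flows_of_def)
    have "sent x f (coflow_completion I x k') = 0"
      by (rule sent_eq_0) (use idle_before_predecessor assms f in auto)
    then have "\<not> flow_completion I x f \<le> coflow_completion I x k'"
      using flow_completion_facts(2)[OF f(1)] coflow_completion_nonneg[OF k(1)] flow_demand_pos[OF f(1)]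
      by simp
    then show ?thesis using coflow_completion_ge[OF f(1)] f by simp
  qed
qed

text \<open>Taking \<open>s\<close> to be 0 gives the release constraint of the LP, and taking
  \<open>s\<close> to be the completion time of a predecessor gives the precedence
  constraint.\<close>

lemma port_load_after:
  assumes q: "q \<in> {inp, outp}" and i: "i \<in> {1..ports I}" and s: "0 \<le> s" "s \<le> coflow_completion I x k"
    and idle: "\<And>f u. \<lbrakk>f \<in> flows I; cofl f = k; 0 \<le> u; u < s\<rbrakk> \<Longrightarrow> x f u = 0"
  shows "s + port_load I q i k \<le> coflow_completion I x k"
proof -
  let ?F = "{f. f \<in> flows I \<and> q f = i \<and> cofl f = k}" and ?t = "coflow_completion I x k"
  have "port_load I q i k \<le> (\<Sum>f\<in>?F. sent x f ?t)"
    unfolding port_load_def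
  proof (rule sum_mono)
    fix f assume "f \<in> ?F"
    then show "flow_demand I f \<le> sent x f ?t"
      using flow_completion_facts(2)[of f ?t] coflow_completion_ge[of f] s by auto
  qed
  also have "\<dots> \<le> (\<Sum>f\<in>?F. sent x f s) + (?t - s)"
    by (rule port_work[OF q i]) (use s in auto)
  also have "(\<Sum>f\<in>?F. sent x f s) = 0"
    by (intro sum.neutral ballI sent_eq_0) (use idle in auto)
  finally show ?thesis by simp
qed

lemma lp_feasible_coflow_completion: "lp_feasible I (coflow_completion I x)"
  unfolding lp_feasible_iff
proof (intro ballI conjI allI impI)
  fix q :: "'k flow \<Rightarrow> nat" and i assume q: "q \<in> {inp, outp}" and i: "i \<in> {1..ports I}"
  show "port_load I q i k \<le> coflow_completion I x k" if "k \<in> coflows I" for k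
    using port_load_after[OF q i, of 0 k] coflow_completion_nonneg[OF that] by simp
  show "case e of (k', k) \<Rightarrow> coflow_completion I x k' + port_load I q i k \<le> coflow_completion I x k"
    if "e \<in> prec I" for e
  proof (cases e)
    case (Pair k' k)
    then have "k' \<in> coflows I" using that prec_subset by auto
    then show ?thesis
      using port_load_after[OF q i, of "coflow_completion I x k'" k] that Pair
        coflow_completion_nonneg coflow_completion_prec idle_before_predecessor by auto
  qed
  fix S assume S: "S \<subseteq> coflows I"
  show "1/2 * ((\<Sum>k\<in>S. (port_load I q i k)\<^sup>2) + (\<Sum>k\<in>S. port_load I q i k)\<^sup>2)
      \<le> (\<Sum>k\<in>S. port_load I q i k * coflow_completion I x k)"
  proof (rule weighted_completion_bound)
    show "finite S" using S finite_coflows by (rule finite_subset)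
    show "0 \<le> port_load I q i k" for k by (rule port_load_nonneg)
    fix k assume "k \<in> S"
    \<comment> \<open>Everything that the coflows in \<open>?S\<close> demand on this port has been
      sent by \<open>?t\<close>, and unit capacity limits that amount to \<open>?t\<close>.\<close>
    let ?t = "coflow_completion I x k"
    let ?S = "{m. m \<in> S \<and> coflow_completion I x m \<le> ?t}"
    let ?F = "{f. f \<in> flows I \<and> q f = i \<and> cofl f \<in> ?S}"
    have t: "0 \<le> ?t" using \<open>k \<in> S\<close> S coflow_completion_nonneg by auto
    have "(\<Sum>m\<in>?S. port_load I q i m) = (\<Sum>f\<in>?F. flow_demand I f)"
      using S by (intro sum_port_load) auto
    also have "\<dots> \<le> (\<Sum>f\<in>?F. sent x f ?t)"
    proof (rule sum_mono)
      fix f assume "f \<in> ?F"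
      then show "flow_demand I f \<le> sent x f ?t"
        using flow_completion_facts(2)[of f ?t] coflow_completion_ge[of f] t by auto
    qed
    also have "\<dots> \<le> (\<Sum>f\<in>?F. sent x f 0) + (?t - 0)"
      by (rule port_work[OF q i]) (use t in auto)
    finally show "(\<Sum>m\<in>?S. port_load I q i m) \<le> ?t" by simp
  qed
qed

end

section \<open>Existence of an optimal LP solution\<close>

context zero_release
begin

lemma some_port: "1 \<in> {1..ports I}"
  using valid by (simp add: valid_instance_def)

lemma lp_feasibleD:
  assumes "lp_feasible I C" "q \<in> {inp, outp}" "i \<in> {1..ports I}"
  shows "k \<in> coflows I \<Longrightarrow> port_load I q i k \<le> C k"
    and "(k', k) \<in> prec I \<Longrightarrow> C k' + port_load I q i k \<le> C k"
    and "S \<subseteq> coflows I \<Longrightarrow>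
      1/2 * ((\<Sum>k\<in>S. (port_load I q i k)\<^sup>2) + (\<Sum>k\<in>S. port_load I q i k)\<^sup>2)
        \<le> (\<Sum>k\<in>S. port_load I q i k * C k)"
  using assms unfolding lp_feasible_iff by blast+

lemma lp_feasible_nonneg: "lp_feasible I C \<Longrightarrow> k \<in> coflows I \<Longrightarrow> 0 \<le> C k"
  using lp_feasibleD(1)[of C inp 1 k] some_port port_load_nonneg[of inp 1 k] by simp

lemma sum_port_load_le_total:
  assumes "S \<subseteq> coflows I"
  shows "(\<Sum>k\<in>S. port_load I q i k) \<le> (\<Sum>f\<in>flows I. flow_demand I f)"
  unfolding sum_port_load[OF assms]
  by (rule sum_mono2) (auto simp: flow_demand_def)

text \<open>Allows solutions to be reset to 0 outside the coflows, which the compactness argument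
  requires.\<close>

lemma lp_feasible_cong:
  assumes "\<And>k. k \<in> coflows I \<Longrightarrow> C k = C' k"
  shows "lp_feasible I C \<longleftrightarrow> lp_feasible I C'"
proof -
  have "(\<Sum>k\<in>S. port_load I q i k * C k) = (\<Sum>k\<in>S. port_load I q i k * C' k)" if "S \<subseteq> coflows I" for S q i
    using that assms by (intro sum.cong) auto
  moreover have "C (fst e) = C' (fst e)" "C (snd e) = C' (snd e)" if "e \<in> prec I" for e
    using that prec_subset assms by auto
  ultimately show ?thesis
    unfolding lp_feasible_iff case_prod_unfold using assms by (simp cong: ball_cong)
qed

text \<open>Coflows of weight 0 can have arbitrarily large \<open>C k\<close> in near-optimal solutions; cutting off at
  bounds \<open>M\<close> that grow along the precedence relation makes the search space compact.\<close>

lemma lp_feasible_min: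
  assumes C: "lp_feasible I C"
    and M: "\<And>k. k \<in> coflows I \<Longrightarrow> (\<Sum>f\<in>flows I. flow_demand I f) \<le> M k"
    and M_prec: "\<And>k' k. (k', k) \<in> prec I \<Longrightarrow> M k' + (\<Sum>f\<in>flows I. flow_demand I f) \<le> M k"
  shows "lp_feasible I (\<lambda>k. min (C k) (M k))"
  unfolding lp_feasible_iff
proof (intro ballI conjI allI impI)
  fix q :: "'k flow \<Rightarrow> nat" and i assume q: "q \<in> {inp, outp}" and i: "i \<in> {1..ports I}"
  let ?l = "port_load I q i" and ?T = "\<Sum>f\<in>flows I. flow_demand I f"
  have l_le: "?l k \<le> ?T" if "k \<in> coflows I" for k
    using sum_port_load_le_total[of "{k}" q i] that by simp
  note C1 = lp_feasibleD(1)[OF C q i] and C2 = lp_feasibleD(2)[OF C q i] and C3 = lp_feasibleD(3)[OF C q i]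
  show "?l k \<le> min (C k) (M k)" if "k \<in> coflows I" for k
    using C1[OF that] l_le[OF that] M[OF that] by simp
  show "case e of (k', k) \<Rightarrow> min (C k') (M k') + ?l k \<le> min (C k) (M k)" if "e \<in> prec I" for e
  proof (cases e)
    case (Pair k' k)
    \<comment> \<open>When \<open>C k\<close> is cut, the increment of \<open>M\<close> along the
      edge already exceeds any port load; otherwise the old inequality suffices.\<close>
    then show ?thesis using C2[of k' k] M_prec[of k' k] l_le[of k] that prec_subset by auto
  qed
  fix S assume S: "S \<subseteq> coflows I"
  then have fin: "finite S" using finite_coflows by (rule finite_subset)
  \<comment> \<open>On the uncut part \<open>A\<close> the old load inequality survives. On the cut
    part \<open>D\<close> each value is at least the total demand, hence at least
    \<open>a + d\<close>. The two bounds add up to the claim because the squares over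
    \<open>D\<close> sum to at most \<open>d * d\<close>.\<close>
  define A D where "A = {k \<in> S. C k \<le> M k}" and "D = S - A"
  have AD: "A \<subseteq> S" "D \<subseteq> S" "S = A \<union> D" "A \<inter> D = {}" "finite A" "finite D"
    using fin by (auto simp: A_def D_def)
  have split: "(\<Sum>k\<in>S. g k) = (\<Sum>k\<in>A. g k) + (\<Sum>k\<in>D. g k)" for g :: "'k \<Rightarrow> real"
    using AD by (simp add: sum.union_disjoint)
  define a d where "a = (\<Sum>k\<in>A. ?l k)" and "d = (\<Sum>k\<in>D. ?l k)"
  have "d \<ge> 0" unfolding d_def by (intro sum_nonneg port_load_nonneg)
  have "(\<Sum>k\<in>D. (?l k)\<^sup>2) \<le> (\<Sum>k\<in>D. ?l k * d)"
    unfolding power2_eq_square d_def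
    by (intro sum_mono mult_left_mono member_le_sum port_load_nonneg) (use AD in auto)
  then have sq: "(\<Sum>k\<in>D. (?l k)\<^sup>2) \<le> d * d" by (simp add: d_def sum_distrib_right)
  have "a + d \<le> ?T" using sum_port_load_le_total[OF S, of q i] by (simp add: a_def d_def split)
  then have "(a + d) * d \<le> ?T * d" using \<open>d \<ge> 0\<close> by (rule mult_right_mono)
  moreover have "?T * d \<le> (\<Sum>k\<in>D. ?l k * min (C k) (M k))"
    unfolding d_def sum_distrib_left
  proof (rule sum_mono)
    fix k assume k: "k \<in> D"
    then have "k \<in> coflows I" using S unfolding D_def by blast
    have "min (C k) (M k) = M k" using k unfolding A_def D_def by (simp add: min_def)
    moreover have "?T * ?l k \<le> M k * ?l k"
      by (rule mult_right_mono[OF M[OF \<open>k \<in> coflows I\<close>] port_load_nonneg])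
    ultimately show "?T * ?l k \<le> ?l k * min (C k) (M k)" by (simp only: mult.commute)
  qed
  moreover have "(\<Sum>k\<in>A. ?l k * min (C k) (M k)) = (\<Sum>k\<in>A. ?l k * C k)"
    by (rule sum.cong) (simp_all add: A_def)
  moreover have "1/2 * ((\<Sum>k\<in>A. (?l k)\<^sup>2) + a\<^sup>2) \<le> (\<Sum>k\<in>A. ?l k * C k)"
    unfolding a_def by (rule C3[OF order_trans[OF AD(1) S]])
  ultimately show "1/2 * ((\<Sum>k\<in>S. (?l k)\<^sup>2) + (\<Sum>k\<in>S. ?l k)\<^sup>2) \<le> (\<Sum>k\<in>S. ?l k * min (C k) (M k))"
    using sq unfolding split a_def[symmetric] d_def[symmetric]
    by (simp add: power2_eq_square algebra_simps)
qed

text \<open>In the product topology each constraint compares continuous functions of the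
  coordinates, and the premises of the implications do not depend on \<open>C\<close>.\<close>

lemma closed_lp_feasible: "closed {C. lp_feasible I C}"
  unfolding lp_feasible_iff Ball_def case_prod_unfold
  by (intro closed_Collect_all closed_Collect_imp closed_Collect_conj closed_Collect_le open_Collect_const
      continuous_intros continuous_on_product_coordinates)

text \<open>Cutting maps every feasible solution into a compact set without raising its value, so a
  minimum over that set is a global one.\<close>

lemma lp_optimal_exists:
  assumes "lp_feasible I C0"
  shows "\<exists>C. lp_optimal I C"
proof -
  define T where "T = (\<Sum>f\<in>flows I. flow_demand I f)"
  have T: "0 \<le> T" unfolding T_def by (rule sum_nonneg) (simp add: flow_demand_def)
  \<comment> \<open>The number of ancestors strictly increases along an edge, since
    \<open>k'\<close> is an ancestor of \<open>k\<close> but, by acyclicity, not of itself. So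
    \<open>M\<close> grows by at least \<open>T\<close>; the summand 1 keeps \<open>M\<close> at
    least \<open>T\<close> at coflows without ancestors.\<close>
  define h where "h k = card {k'. (k', k) \<in> (prec I)\<^sup>+}" for k
  define M where "M k = T * (real (h k) + 1)" for k
  have fin: "finite {k'. (k', k) \<in> (prec I)\<^sup>+}" for k
    by (rule finite_subset[of _ "coflows I"]) (use trancl_prec_subset in auto)
  have h_less: "h k' < h k" if "(k', k) \<in> prec I" for k' k
    unfolding h_def
  proof (rule psubset_card_mono[OF fin])
    have "k' \<notin> {m. (m, k') \<in> (prec I)\<^sup>+}" using acyclic_prec by (auto simp: acyclic_def)
    moreover have "k' \<in> {m. (m, k) \<in> (prec I)\<^sup>+}" using that by auto
    moreover have "{m. (m, k') \<in> (prec I)\<^sup>+} \<subseteq> {m. (m, k) \<in> (prec I)\<^sup>+}"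
      using that by (auto intro: trancl_into_trancl)
    ultimately show "{m. (m, k') \<in> (prec I)\<^sup>+} \<subset> {m. (m, k) \<in> (prec I)\<^sup>+}" by blast
  qed
  have M_prec: "M k' + T \<le> M k" if "(k', k) \<in> prec I" for k' k
  proof -
    have "T * (real (h k') + 1) \<le> T * real (h k)"
      by (rule mult_left_mono[OF _ T]) (use h_less[OF that] in linarith)
    then show ?thesis by (simp add: M_def algebra_simps)
  qed
  have M: "T \<le> M k" for k using T by (simp add: M_def algebra_simps)
  define cut where "cut C = (\<lambda>k. if k \<in> coflows I then min (C k) (M k) else 0)" for C :: "'k \<Rightarrow> real"
  \<comment> \<open>The type of coflows may be infinite, so compactness comes from Tychonoff, with
    singleton factors outside the coflows.\<close>
  define K where "K = PiE UNIV (\<lambda>k. if k \<in> coflows I then {0..M k} else {0 :: real})"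
  have "compactin (product_topology (\<lambda>i. euclidean) UNIV) K"
    unfolding K_def compactin_PiE by auto
  then have "compact K" by (simp add: euclidean_product_topology)
  then have compact: "compact (K \<inter> {C. lp_feasible I C})" using closed_lp_feasible by (rule compact_Int_closed)
  have cut: "lp_feasible I (cut C)" "cut C \<in> K" "lp_value I (cut C) \<le> lp_value I C" if "lp_feasible I C" for C
  proof -
    have "lp_feasible I (\<lambda>k. min (C k) (M k))"
      using that by (rule lp_feasible_min) (use M M_prec in \<open>auto simp: T_def\<close>)
    then show "lp_feasible I (cut C)" using lp_feasible_cong[of "cut C"] by (simp add: cut_def)
    show "cut C \<in> K" using lp_feasible_nonneg[OF that] order_trans[OF T M] by (auto simp: K_def cut_def)
    show "lp_value I (cut C) \<le> lp_value I C" unfolding lp_value_def cut_def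
      by (intro sum_mono mult_left_mono) (auto simp: weight_nonneg)
  qed
  have "continuous_on (K \<inter> {C. lp_feasible I C}) (lp_value I)"
    unfolding lp_value_def
    by (intro continuous_intros continuous_on_subset[OF continuous_on_product_coordinates]) auto
  then obtain C where C: "lp_feasible I C"
    "\<And>C'. C' \<in> K \<Longrightarrow> lp_feasible I C' \<Longrightarrow> lp_value I C \<le> lp_value I C'"
    using continuous_attains_inf[OF compact, of "lp_value I"] cut(1,2)[OF assms] by blast
  then have "lp_optimal I C" unfolding lp_optimal_def using cut by (meson order_trans)
  then show ?thesis by blast
qed

text \<open>Origin of the constant 2: for the total load \<open>a\<close>, the LP gives
  \<open>a * a / 2\<close> at most the weighted sum, which is at most \<open>a * C k\<close>;
  dividing by \<open>a\<close> leaves only the trivial case that \<open>a\<close> is 0.\<close>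

lemma lp_load_le:
  assumes C: "lp_feasible I C" and q: "q \<in> {inp, outp}" and i: "i \<in> {1..ports I}" and k: "k \<in> coflows I"
  shows "(\<Sum>m | m \<in> coflows I \<and> C m \<le> C k. port_load I q i m) \<le> 2 * C k"
proof -
  let ?S = "{m. m \<in> coflows I \<and> C m \<le> C k}" and ?l = "port_load I q i"
  define a where "a = (\<Sum>m\<in>?S. ?l m)"
  have "1/2 * ((\<Sum>k\<in>?S. (?l k)\<^sup>2) + a\<^sup>2) \<le> (\<Sum>m\<in>?S. ?l m * C m)"
    unfolding a_def by (rule lp_feasibleD(3)[OF C q i]) auto
  also have "\<dots> \<le> (\<Sum>m\<in>?S. ?l m * C k)"
    by (intro sum_mono mult_left_mono port_load_nonneg) auto
  also have "\<dots> = a * C k" by (simp add: a_def sum_distrib_right)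
  finally have "a * a \<le> a * (2 * C k)"
    using sum_nonneg[of ?S "\<lambda>k. (?l k)\<^sup>2"] by (simp add: power2_eq_square)
  moreover have "0 \<le> a" unfolding a_def by (intro sum_nonneg port_load_nonneg)
  ultimately have "a \<le> 2 * C k"
    using lp_feasible_nonneg[OF C k] by (cases "a = 0") auto
  then show ?thesis by (simp add: a_def)
qed

section \<open>Directed paths\<close>

lemma directed_path_last:
  "\<lbrakk>directed_path I p; k \<in> set p\<rbrakk> \<Longrightarrow> (k, last p) \<in> (prec I)\<^sup>*"
proof (induction p arbitrary: k)
  case Nil
  then show ?case by simp
next
  case (Cons a p)
  show ?case
  proof (cases "p = []")
    case True
    then show ?thesis using Cons.prems by simp
  next
    case False
    have p: "directed_path I p" "(a, hd p) \<in> prec I"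
      using Cons.prems False by (auto simp: directed_path_def successively_Cons)
    show ?thesis
    proof (cases "k = a")
      case True
      then show ?thesis using p Cons.IH[OF p(1) hd_in_set[OF False]] \<open>p \<noteq> []\<close> False
        by (simp add: converse_rtrancl_into_rtrancl)
    next
      case False
      then show ?thesis using Cons p \<open>p \<noteq> []\<close> by simp
    qed
  qed
qed

end

text \<open>A repeated \<open>k\<close> would reach \<open>last p\<close> along the path and close a
  cycle with the new edge.\<close>

lemma (in zero_release) directed_path_snoc:
  assumes "directed_path I p" "p \<noteq> []" "(last p, k) \<in> prec I"
  shows "directed_path I (p @ [k])"
proof -
  have "k \<notin> set p"
  proof
    assume "k \<in> set p"
    then have "(k, last p) \<in> (prec I)\<^sup>*" using directed_path_last assms by blast
    then have "(k, k) \<in> (prec I)\<^sup>+" using assms(3) by (rule rtrancl_into_trancl1)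
    then show False using acyclic_prec by (simp add: acyclic_def)
  qed
  then show ?thesis
    using assms prec_subset by (auto simp: directed_path_def successively_append_iff)
qed

text \<open>A closure step is refined into single edges, possibly through coflows without flows. The
  strict growth in length pays for one further stage of waiting.\<close>

lemma (in zero_release) directed_path_extend:
  assumes "(k', k) \<in> (prec I)\<^sup>+" "directed_path I p" "p \<noteq> []" "last p = k'"
  shows "\<exists>p'. directed_path I p' \<and> p' \<noteq> [] \<and> last p' = k \<and> length p < length p'"
  using assms
proof (induction rule: trancl_induct)
  case (base m)
  then show ?case using directed_path_snoc[of p m] by (intro exI[of _ "p @ [m]"]) auto
next
  case (step m n)
  then obtain p' where "directed_path I p'" "p' \<noteq> []" "last p' = m" "length p < length p'" by blast
  then show ?case using step directed_path_snoc[of p' n] by (intro exI[of _ "p' @ [n]"]) auto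
qed

lemma (in zero_release) length_le_max_path_coflows:
  assumes "directed_path I p"
  shows "length p \<le> max_path_coflows I"
  unfolding max_path_coflows_def
proof (rule Max_ge)
  have "length p' \<le> card (coflows I)" if "directed_path I p'" for p'
    using that card_mono[OF finite_coflows, of "set p'"] by (simp add: directed_path_def distinct_card)
  then have "{length p | p. directed_path I p} \<subseteq> {..card (coflows I)}" by blast
  then show "finite {length p | p. directed_path I p}" by (rule finite_subset) simp
qed (use assms in blast)

section \<open>The completion times of the algorithm\<close>

text \<open>Separates the analysis from the runs: greedy selection and tie breaking enter only
  through \<open>busy\<close>.\<close>

locale list_schedule = feasible_schedule I x
  for I :: "'k coflow_instance" and x :: "'k schedule" +
  fixes C :: "'k \<Rightarrow> real"
  assumes lp_C: "lp_feasible I C"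
    and busy: "\<lbrakk>0 \<le> u; f \<in> flows I; sent x f u < flow_demand I f;
      \<And>g. \<lbrakk>g \<in> flows I; (cofl g, cofl f) \<in> (prec I)\<^sup>+\<rbrakk> \<Longrightarrow> flow_demand I g \<le> sent x g u\<rbrakk>
     \<Longrightarrow> \<exists>g\<in>flows I. x g u = 1 \<and> C (cofl g) \<le> C (cofl f) \<and> (inp g = inp f \<or> outp g = outp f)"
begin

lemma flow_completion_after_ready:
  assumes f: "f \<in> flows I" and r: "0 \<le> r"
    and ready: "\<And>g. \<lbrakk>g \<in> flows I; (cofl g, cofl f) \<in> (prec I)\<^sup>+\<rbrakk> \<Longrightarrow> flow_completion I x g \<le> r"
  shows "flow_completion I x f \<le> r + 4 * C (cofl f)"
proof (rule ccontr)
  assume "\<not> ?thesis"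
  \<comment> \<open>A point strictly before completion keeps \<open>f\<close> incomplete on the
    whole closed interval from \<open>r\<close> to \<open>t\<close>, whose length still exceeds
    \<open>4 * C (cofl f)\<close>.\<close>
  then obtain t where t: "r + 4 * C (cofl f) < t" "t < flow_completion I x f"
    using dense by (auto simp: not_le)
  have "r \<le> t" using t lp_feasible_nonneg[OF lp_C cofl_in_coflows[OF f]] by simp
  let ?S = "{m. m \<in> coflows I \<and> C m \<le> C (cofl f)}"
  define F where "F q = {g. g \<in> flows I \<and> q g = q f \<and> cofl g \<in> ?S}" for q :: "'k flow \<Rightarrow> nat"
  have F: "F q \<subseteq> flows I" "finite (F q)" for q by (auto simp: F_def)
  have int: "(\<lambda>u. \<Sum>g\<in>F q. x g u) integrable_on {r..t}" for q
    using F r \<open>r \<le> t\<close> by (intro integrable_sum rate_integrable_interval) auto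
  have F_le: "integral {r..t} (\<lambda>u. \<Sum>g\<in>F q. x g u) \<le> 2 * C (cofl f)"
    if q: "q \<in> {inp, outp}" for q
  proof -
    have "integral {r..t} (\<lambda>u. \<Sum>g\<in>F q. x g u) = (\<Sum>g\<in>F q. integral {r..t} (x g))"
      using F r \<open>r \<le> t\<close> by (intro integral_sum rate_integrable_interval) auto
    also have "\<dots> \<le> (\<Sum>g\<in>F q. flow_demand I g)"
    proof (rule sum_mono)
      fix g assume "g \<in> F q"
      then have g: "g \<in> flows I" using F by auto
      then show "integral {r..t} (x g) \<le> flow_demand I g"
        using sent_combine[OF g r \<open>r \<le> t\<close>] sent_nonneg[OF g r] sent_le_demand[OF g, of t] r \<open>r \<le> t\<close> by simp
    qed
    also have "\<dots> = (\<Sum>m\<in>?S. port_load I q (q f) m)"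
      unfolding F_def by (rule sum_port_load[symmetric]) auto
    also have "\<dots> \<le> 2 * C (cofl f)"
      by (rule lp_load_le[OF lp_C q _ cofl_in_coflows[OF f]])
        (use q inp_in_ports[OF f] outp_in_ports[OF f] in auto)
    finally show ?thesis .
  qed
  \<comment> \<open>At every moment the flow supplied by \<open>busy\<close> has rate 1 and lies in
    \<open>F inp\<close> or \<open>F outp\<close>, so the two port rates sum to at least 1.\<close>
  have "integral {r..t} (\<lambda>_. 1) \<le> integral {r..t} (\<lambda>u. (\<Sum>g\<in>F inp. x g u) + (\<Sum>g\<in>F outp. x g u))"
  proof (rule integral_le)
    fix u assume u: "u \<in> {r..t}"
    then have u0: "0 \<le> u" using r by simp
    have "sent x f u < flow_demand I f"
      using flow_completion_facts(2)[OF f u0] u t by simp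
    moreover have "flow_demand I g \<le> sent x g u" if "g \<in> flows I" "(cofl g, cofl f) \<in> (prec I)\<^sup>+" for g
      using flow_completion_facts(2)[OF that(1) u0] ready[OF that] u by simp
    ultimately obtain g where g: "g \<in> flows I" "x g u = 1" "C (cofl g) \<le> C (cofl f)" "inp g = inp f \<or> outp g = outp f"
      using busy[OF u0 f] by blast
    have nonneg: "0 \<le> x h u" if "h \<in> F q" for h q
      using that F u0 by (intro rate_nonneg) auto
    have "1 \<le> (\<Sum>h\<in>F q. x h u)" if "g \<in> F q" for q
      using member_le_sum[OF that, of "\<lambda>h. x h u", OF nonneg[where q = q] F(2)] g(2) by simp
    moreover have "g \<in> F inp \<or> g \<in> F outp"
      using g cofl_in_coflows by (auto simp: F_def)
    moreover have "0 \<le> (\<Sum>h\<in>F q. x h u)" for q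
      by (intro sum_nonneg nonneg)
    ultimately show "1 \<le> (\<Sum>g\<in>F inp. x g u) + (\<Sum>g\<in>F outp. x g u)"
      by (metis add_increasing add_increasing2)
  qed (use int in \<open>auto intro: integrable_add\<close>)
  also have "\<dots> = integral {r..t} (\<lambda>u. \<Sum>g\<in>F inp. x g u) + integral {r..t} (\<lambda>u. \<Sum>g\<in>F outp. x g u)"
    by (intro integral_add int)
  finally have "t - r \<le> 4 * C (cofl f)"
    using F_le[of inp] F_le[of outp] \<open>r \<le> t\<close> by simp
  then show False using t by simp
qed

lemma lp_prec_le:
  assumes "(k', k) \<in> prec I"
  shows "C k' \<le> C k"
proof -
  have "C k' + port_load I inp 1 k \<le> C k"
    using lp_feasibleD(2)[OF lp_C _ some_port] assms by simp
  then show ?thesis using port_load_nonneg[of inp 1 k] by simp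
qed

lemma lp_trancl_le: "(k', k) \<in> (prec I)\<^sup>+ \<Longrightarrow> C k' \<le> C k"
  by (induction rule: trancl_induct) (auto dest: lp_prec_le)

text \<open>The path follows backwards the last completing flows that each coflow waits for.\<close>

lemma coflow_completion_path:
  "k \<in> coflows I \<Longrightarrow> \<exists>p. directed_path I p \<and> p \<noteq> [] \<and> last p = k \<and>
     coflow_completion I x k \<le> 4 * real (length p) * C k"
proof (induction k rule: wf_induct_rule[OF wf_trancl[OF wf_prec]])
  case (1 k)
  let ?G = "{g \<in> flows I. (cofl g, k) \<in> (prec I)\<^sup>+}"
  have Ck: "0 \<le> C k" using lp_feasible_nonneg[OF lp_C] 1 by blast
  \<comment> \<open>From \<open>r\<close> on all flows of \<open>k\<close> are ready. The inequality
    reserves \<open>4 * C k\<close> of the path bound for \<open>k\<close> itself.\<close>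
  have "\<exists>p r. directed_path I p \<and> p \<noteq> [] \<and> last p = k \<and> 0 \<le> r \<and>
      (\<forall>g\<in>?G. flow_completion I x g \<le> r) \<and> r + 4 * C k \<le> 4 * real (length p) * C k"
  proof (cases "?G = {}")
    case True
    then show ?thesis using "1.prems" by (intro exI[of _ "[k]"] exI[of _ 0]) (auto simp: directed_path_def)
  next
    case False
    define r where "r = Max (flow_completion I x ` ?G)"
    have "r \<in> flow_completion I x ` ?G" unfolding r_def using False by (intro Max_in) auto
    then obtain g where g: "g \<in> flows I" "(cofl g, k) \<in> (prec I)\<^sup>+" "r = flow_completion I x g" by auto
    obtain p0 where p0: "directed_path I p0" "p0 \<noteq> []" "last p0 = cofl g"
      "coflow_completion I x (cofl g) \<le> 4 * real (length p0) * C (cofl g)"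
      using "1.IH"[OF g(2)] cofl_in_coflows[OF g(1)] by blast
    obtain p where p: "directed_path I p" "p \<noteq> []" "last p = k" "length p0 < length p"
      using directed_path_extend[OF g(2) p0(1,2,3)] by blast
    have "r \<le> 4 * real (length p0) * C (cofl g)"
      using g coflow_completion_ge[of g] p0(4) by simp
    \<comment> \<open>Monotonicity of \<open>C\<close> restates the charges of all earlier stages in
      terms of \<open>C k\<close>, which turns the sum over the chain into a multiple of its
      length.\<close>
    also have "\<dots> \<le> 4 * real (length p0) * C k"
      by (intro mult_left_mono lp_trancl_le g) auto
    finally have "r + 4 * C k \<le> 4 * (real (length p0) + 1) * C k" by (simp add: algebra_simps)
    also have "\<dots> \<le> 4 * real (length p) * C k"
      by (intro mult_right_mono Ck) (use p in auto)
    finally have "r + 4 * C k \<le> 4 * real (length p) * C k" .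
    moreover have "flow_completion I x g' \<le> r" if "g' \<in> ?G" for g'
      unfolding r_def using that by (intro Max_ge) auto
    moreover have "0 \<le> r" using flow_completion_facts(1)[OF g(1)] g(3) by simp
    ultimately show ?thesis using p(1-3) by blast
  qed
  then obtain p r where p: "directed_path I p" "p \<noteq> []" "last p = k" "0 \<le> r"
    "\<And>g. g \<in> ?G \<Longrightarrow> flow_completion I x g \<le> r" "r + 4 * C k \<le> 4 * real (length p) * C k" by blast
  have "coflow_completion I x k \<le> r + 4 * C k"
  proof (rule coflow_completion_le)
    fix f assume f: "f \<in> flows I" "(cofl f, k) \<in> (prec I)\<^sup>*"
    show "flow_completion I x f \<le> r + 4 * C k"
    proof (cases "cofl f = k")
      case True
      then show ?thesis using flow_completion_after_ready[OF f(1) p(4)] p(5) by simp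
    next
      case False
      then have "(cofl f, k) \<in> (prec I)\<^sup>+" using f(2) by (auto simp: rtrancl_eq_or_trancl)
      then show ?thesis using p(5)[of f] f(1) Ck by simp
    qed
  qed (use "1.prems" p(4) Ck in simp_all)
  then have "coflow_completion I x k \<le> 4 * real (length p) * C k" using p(6) by (rule order_trans)
  then show ?case using p(1-3) by blast
qed

lemma cost_le: "cost I x \<le> 4 * real (max_path_coflows I) * lp_value I C"
proof -
  have "coflow_completion I x k \<le> 4 * real (max_path_coflows I) * C k" if k: "k \<in> coflows I" for k
  proof -
    obtain p where p: "directed_path I p" "coflow_completion I x k \<le> 4 * real (length p) * C k"
      using coflow_completion_path[OF k] by blast
    note p(2)
    also have "4 * real (length p) * C k \<le> 4 * real (max_path_coflows I) * C k"
      using length_le_max_path_coflows[OF p(1)] lp_feasible_nonneg[OF lp_C k]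
      by (intro mult_right_mono) auto
    finally show ?thesis .
  qed
  then have "cost I x \<le> (\<Sum>k\<in>coflows I. weight I k * (4 * real (max_path_coflows I) * C k))"
    unfolding cost_def by (intro sum_mono mult_left_mono weight_nonneg)
  also have "\<dots> = 4 * real (max_path_coflows I) * lp_value I C"
    by (simp add: lp_value_def sum_distrib_left mult_ac)
  finally show ?thesis .
qed

end

section \<open>Feasibility of runs and comparison with the optimum\<close>

context zero_release
begin

lemma sum_matching_le_1:
  assumes "\<And>f g. \<lbrakk>y f \<noteq> 0; y g \<noteq> 0; q f = q g\<rbrakk> \<Longrightarrow> f = g" "\<And>f. y f \<le> (1 :: real)"
  shows "(\<Sum>f | f \<in> flows I \<and> q f = i. y f) \<le> 1"
proof (cases "\<exists>f. f \<in> flows I \<and> q f = i \<and> y f \<noteq> 0")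
  case True
  then obtain f where f: "f \<in> flows I" "q f = i" "y f \<noteq> 0" by blast
  have "y g = 0" if g: "g \<in> {f. f \<in> flows I \<and> q f = i} - {f}" for g
  proof (rule ccontr)
    assume "y g \<noteq> 0"
    then have "g = f" by (rule assms(1)) (use f g in simp_all)
    then show False using g by simp
  qed
  then have "(\<Sum>f | f \<in> flows I \<and> q f = i. y f) = (\<Sum>f\<in>{f}. y f)"
    using f by (intro sum.mono_neutral_right) simp_all
  then show ?thesis using assms(2) by simp
next
  case False
  then have "(\<Sum>f | f \<in> flows I \<and> q f = i. y f) = 0" by (intro sum.neutral) auto
  then show ?thesis by simp
qed

text \<open>Without coflows the start time is an unspecified minimum of the empty set, and the run is empty.\<close>

lemma list_run_start:
  "list_run I C (Min (release I ` coflows I)) r segs \<longleftrightarrow> list_run I C 0 r segs"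
proof (cases "coflows I = {}")
  case True
  then have "flows I = {}" by (auto simp: flows_def)
  then show ?thesis by (auto elim: list_run.cases intro: list_run.finished)
next
  case False
  then have "release I ` coflows I = {0}" using release_0 by force
  then show ?thesis by simp
qed

lemma list_run_feasible:
  assumes run: "list_run I C 0 (flow_demand I) segs"
  shows "feasible I (schedule_of segs)"
proof -
  let ?x = "schedule_of segs"
  have facts: "\<forall>f. \<forall>u\<ge>0. ?x f integrable_on {0..u}"
    "\<forall>f\<in>flows I. (\<forall>u\<ge>0. sent ?x f u \<le> flow_demand I f) \<and> (\<exists>u\<ge>0. sent ?x f u = flow_demand I f)"
    "\<forall>u f g. ?x f u \<noteq> 0 \<longrightarrow> ?x g u \<noteq> 0 \<longrightarrow> inp f = inp g \<or> outp f = outp g \<longrightarrow> f = g"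
    "\<forall>u f. ?x f u \<noteq> 0 \<longrightarrow> (\<forall>g\<in>flows I. (cofl g, cofl f) \<in> (prec I)\<^sup>+ \<longrightarrow> flow_demand I g \<le> sent ?x g u)"
    using list_run_schedule[OF run] by (simp_all add: flow_demand_def)
  have nonneg: "0 \<le> ?x f u" and le_1: "?x f u \<le> 1" for f u
    using schedule_of_01[of segs f u] by auto
  \<comment> \<open>Feasibility is still to be shown, so only the lower-bound property of the
    infimum is available here, not its attainment.\<close>
  have completion: "flow_completion I ?x g \<le> u" if "0 \<le> u" "flow_demand I g \<le> sent ?x g u" for g u
    unfolding flow_completion_def by (rule cInf_lower) (use that in \<open>auto intro: bdd_belowI[of _ 0]\<close>)
  show ?thesis
    unfolding feasible_def
  proof (intro conjI ballI allI impI)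
    show "(\<Sum>f | f \<in> flows I \<and> inp f = i. ?x f t) \<le> 1" for i t
      by (rule sum_matching_le_1) (use facts(3) le_1 in blast)+
    show "(\<Sum>f | f \<in> flows I \<and> outp f = j. ?x f t) \<le> 1" for j t
      by (rule sum_matching_le_1) (use facts(3) le_1 in blast)+
    show "release I (cofl f) \<le> t" if "f \<in> flows I" "0 \<le> t" for f t
      using that cofl_in_coflows release_0 by simp
    show "release I k' \<le> t" if "0 \<le> t" "(k', cofl f) \<in> (prec I)\<^sup>+" for k' f t
      using that trancl_prec_subset release_0[of k'] by auto
    show "flow_completion I ?x g \<le> t"
      if "0 \<le> t" "0 < ?x f t" "(k', cofl f) \<in> (prec I)\<^sup>+" "g \<in> flows_of I k'" for f g t k'
    proof (rule completion)
      have "g \<in> flows I" "cofl g = k'" "schedule_of segs f t \<noteq> 0" using that by (auto simp: flows_of_def)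
      then show "flow_demand I g \<le> sent (schedule_of segs) g t" using facts(4) that(3) by blast
    qed (rule that)
  qed (use nonneg facts(1,2) in auto)
qed

lemma list_run_list_schedule:
  assumes run: "list_run I C 0 (flow_demand I) segs" and C: "lp_feasible I C"
  shows "list_schedule I (schedule_of segs) C"
proof unfold_locales
  show "feasible I (schedule_of segs)" using run by (rule list_run_feasible)
  show "lp_feasible I C" by (rule C)
  have "\<forall>u\<ge>0. \<forall>f\<in>flows I. sent (schedule_of segs) f u < flow_demand I f \<longrightarrow>
      (\<forall>g\<in>flows I. (cofl g, cofl f) \<in> (prec I)\<^sup>+ \<longrightarrow> flow_demand I g \<le> sent (schedule_of segs) g u) \<longrightarrow>
      (\<exists>g\<in>flows I. schedule_of segs g u = 1 \<and> C (cofl g) \<le> C (cofl f) \<and> (inp g = inp f \<or> outp g = outp f))"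
    using list_run_schedule[OF run] by (simp add: flow_demand_def)
  then show "\<exists>g\<in>flows I. schedule_of segs g u = 1 \<and> C (cofl g) \<le> C (cofl f) \<and> (inp g = inp f \<or> outp g = outp f)"
    if "0 \<le> u" "f \<in> flows I" "sent (schedule_of segs) f u < flow_demand I f"
      "\<And>g. \<lbrakk>g \<in> flows I; (cofl g, cofl f) \<in> (prec I)\<^sup>+\<rbrakk> \<Longrightarrow> flow_demand I g \<le> sent (schedule_of segs) g u"
    for u f
    using that by blast
qed

lemma list_scheduling_iff:
  "list_scheduling I x \<longleftrightarrow> (\<exists>C segs. lp_optimal I C \<and> list_run I C 0 (flow_demand I) segs \<and> x = schedule_of segs)"
  by (simp add: list_scheduling_def list_run_start)

lemma list_scheduling_approx:
  assumes "list_scheduling I x"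
  shows "feasible I x" "cost I x \<le> 4 * real (max_path_coflows I) * opt I"
proof -
  obtain C segs where C: "lp_optimal I C" and run: "list_run I C 0 (flow_demand I) segs"
    and x: "x = schedule_of segs"
    using assms unfolding list_scheduling_iff by blast
  interpret list_schedule I x C
    unfolding x using run C by (intro list_run_list_schedule) (auto simp: lp_optimal_def)
  show "feasible I x" by (rule feasible)
  have "lp_value I C \<le> cost I y" if "feasible I y" for y
  proof -
    interpret y: feasible_schedule I y using that by unfold_locales
    have "lp_value I C \<le> lp_value I (coflow_completion I y)"
      using C y.lp_feasible_coflow_completion by (simp add: lp_optimal_def)
    then show ?thesis by (simp add: lp_value_def cost_def)
  qed
  \<comment> \<open>The infimum ranges over a nonempty set because the output of the algorithm is
    itself feasible.\<close>
  then have "lp_value I C \<le> opt I"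
    unfolding opt_def using feasible by (intro cInf_greatest) auto
  then have "4 * real (max_path_coflows I) * lp_value I C \<le> 4 * real (max_path_coflows I) * opt I"
    by (intro mult_left_mono) auto
  then show "cost I x \<le> 4 * real (max_path_coflows I) * opt I"
    using cost_le by simp
qed

text \<open>Feasibility of the LP is obtained from a schedule, namely from a run of the algorithm with
  constant, LP-independent priorities.\<close>

lemma list_scheduling_exists: "\<exists>x. list_scheduling I x"
proof -
  obtain segs where "list_run I (\<lambda>_. 0) 0 (flow_demand I) segs" using list_run_exists by blast
  then interpret feasible_schedule I "schedule_of segs"
    by unfold_locales (rule list_run_feasible)
  obtain C where "lp_optimal I C" using lp_optimal_exists[OF lp_feasible_coflow_completion] by blast
  moreover obtain segs where "list_run I C 0 (flow_demand I) segs" using list_run_exists by blast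
  ultimately show ?thesis unfolding list_scheduling_iff by blast
qed

end

theorem theorem6:
  "approx_ratio_at_most
     (\<lambda>I :: 'k coflow_instance. valid_instance I \<and> (\<forall>k\<in>coflows I. release I k = 0))
     list_scheduling
     (\<lambda>I. 4 * real (max_path_coflows I))"
  unfolding approx_ratio_at_most_def
proof (intro allI impI)
  fix I :: "'k coflow_instance"
  assume "valid_instance I \<and> (\<forall>k\<in>coflows I. release I k = 0)"
  then interpret zero_release I by unfold_locales auto
  show "(\<exists>x. list_scheduling I x) \<and>
    (\<forall>x. list_scheduling I x \<longrightarrow> feasible I x \<and> cost I x \<le> 4 * real (max_path_coflows I) * opt I)"
    using list_scheduling_exists list_scheduling_approx by blast
qed

end
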